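(* Let $\{\epsilon_t\}_{t=0}^{T-1}$, $\{\alpha_t\}_{t=0}^{T-1}$, $\{\beta_t\}_{t=0}^{T-1}$ be given sequences of positive numbers and $\epsilon:=\sum_{t=0}^{T-1}\epsilon_t^2$, $\alpha:=\sum_{t=0}^{T-1}\alpha_t$, $\beta:=\sum_{t=0}^{T-1}\beta_t$. Suppose $\alpha+\beta<1$. If the path integral control $\hat u_t=\sum_{i=1}^{n_t}\frac{r(i)}{r}u_t(i)$, $r=\sum_{i=1}^{n_t}r(i)$, is computed with $n_t$ satisfying $$n_t\ge\frac{\left(\hat E_t^r\sqrt{2\|\hat\Omega_t\|\log\frac{2m}{\beta_t}}+\left(\epsilon_t\hat E_t^r+\|\hat E_t^{ru}\|_\infty\right)\sqrt{\frac12\log\frac2{\alpha_t}}\right)^2}{\epsilon_t^2(\hat E_t^r)^4}$$ and $$\hat E_t^r>\sqrt{\frac1{2n_t}\log\frac2{\alpha_t}}$$ for all $t=0,1,\dots,T-1$, then $$\|\hat u-u\|_\infty^2:=\sum_{t=0}^{T-1}\|\hat u_t-u_t\|_\infty^2\le\epsilon$$ with probability greater than or equal to $1-\alpha-\beta$.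
   Context: Linear-quadratic setting: dynamics $X_{t+1}=A_tX_t+B_tU_t+W_t$, $X_t\in\mathbb R^n$, $U_t\in\mathbb R^m$, independent $W_t\sim\mathcal N(0,\Omega_t)$; cost $\mathbb E\sum_{t=0}^{T-1}(\frac12X_t^\top M_tX_t+\frac12U_t^\top N_tU_t)+\mathbb E\frac12X_T^\top M_TX_T$, with $M_t,N_t$ positive definite. Standing assumption: for each $t$ there are $\hat\Omega_t\succ0$ and $\lambda>0$ with $N_t=\lambda\hat\Omega_t^{-1}$ and $B_t\hat\Omega_tB_t^\top=\Omega_t$. $u_t=K_tx_t$ is the optimal LQR input at the current state $x_t$: $K_t=-(B_t^\top\Theta_{t+1}B_t+N_t)^{-1}B_t^\top\Theta_{t+1}A_t$, where $\Theta_T=M_T$ and $\Theta_t=A_t^\top\Theta_{t+1}A_t+M_t-A_t^\top\Theta_{t+1}B_t(B_t^\top\Theta_{t+1}B_t+N_t)^{-1}B_t^\top\Theta_{t+1}A_t$. Path integral scheme: at each time $t$, from the current state $x_t$, draw $n_t$ independent state-control trajectories $\{x_{t:T}(i),u_{t:T-1}(i)\}_{i=1}^{n_t}$ with $x_t(i)=x_t$, $u_k(i)\sim\mathcal N(0,\hat\Omega_k)$ independent, $x_{k+1}(i)=A_kx_k(i)+B_ku_k(i)$, and set $r(i)=\exp\big(-\frac1\lambda\sum_{k=t}^T\frac12x_k(i)^\top M_kx_k(i)\big)$. Empirical means: $\hat E_t^{ru}=\frac1{n_t}\sum_{i=1}^{n_t}r(i)u_t(i)$, $\hat E_t^r=\frac1{n_t}\sum_{i=1}^{n_t}r(i)$.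 Their almost sure limits as $n_t\to\infty$ are $E_t^{ru}$, $E_t^r$, and $u_t=E_t^{ru}/E_t^r$. $\|\hat\Omega_t\|$ is the matrix norm used as sub-Gaussian parameter of $\mathcal N(0,\hat\Omega_t)$; $\|\cdot\|_\infty$ on $\mathbb R^m$ is the maximum norm. *)

theory Defs
  imports "HOL-Probability.Probability"
begin

definition pos_definite :: "real^'n^'n \<Rightarrow> bool" where
  "pos_definite S \<longleftrightarrow> transpose S = S \<and> (\<forall>x. x \<noteq> 0 \<longrightarrow> 0 < x \<bullet> (S *v x))"

definition std_normal_vec :: "(real^'n) measure" where
  "std_normal_vec = density lborel (\<lambda>z. ennreal (\<Prod>i\<in>UNIV. std_normal_density (z $ i)))"

text \<open>
  \<open>Y\<close> has law $N(0,S)$: it is distributed as \<open>L Z\<close> with \<open>Z\<close> standard normal and \<open>L L\<^sup>T = S\<close>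
  (the law of \<open>L Z\<close> depends only on \<open>L L\<^sup>T\<close>). A singular \<open>S\<close> is allowed, as is needed for the
  covariance \<open>B \<Omega> B\<^sup>T\<close> of the disturbance, so a Lebesgue density is not assumed.
\<close>

definition centered_normal :: "'w measure \<Rightarrow> ('w \<Rightarrow> real^'n) \<Rightarrow> real^'n^'n \<Rightarrow> bool" where
  "centered_normal P Y S \<longleftrightarrow> Y \<in> borel_measurable P \<and>
     (\<exists>L :: real^'n^'n. L ** transpose L = S \<and>
        distr P borel Y = distr std_normal_vec borel (\<lambda>z. L *v z))"

text \<open>\<open>riccati A B M N T j\<close> is $\Theta_{T-j}$: the backward recursion counts the steps from the horizon.\<close>

primrec riccati ::
  "(nat \<Rightarrow> real^'n^'n) \<Rightarrow> (nat \<Rightarrow> real^'m^'n) \<Rightarrow> (nat \<Rightarrow> real^'n^'n) \<Rightarrow> (nat \<Rightarrow> real^'m^'m)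
    \<Rightarrow> nat \<Rightarrow> nat \<Rightarrow> real^'n^'n" where
  "riccati A B M N T 0 = M T"
| "riccati A B M N T (Suc j) =
    (let t = T - Suc j; \<Theta> = riccati A B M N T j in
      transpose (A t) ** \<Theta> ** A t + M t
      - transpose (A t) ** \<Theta> ** B t
          ** matrix_inv (transpose (B t) ** \<Theta> ** B t + N t)
          ** transpose (B t) ** \<Theta> ** A t)"

definition lqr_gain ::
  "(nat \<Rightarrow> real^'n^'n) \<Rightarrow> (nat \<Rightarrow> real^'m^'n) \<Rightarrow> (nat \<Rightarrow> real^'n^'n) \<Rightarrow> (nat \<Rightarrow> real^'m^'m)
    \<Rightarrow> nat \<Rightarrow> nat \<Rightarrow> real^'n^'m" where
  "lqr_gain A B M N T t =
    (let \<Theta> = riccati A B M N T (T - Suc t) in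
      - (matrix_inv (transpose (B t) ** \<Theta> ** B t + N t) ** transpose (B t) ** \<Theta> ** A t))"

text \<open>\<open>rollout A B t x v j\<close> is $x_{t+j}$ for the noise-free trajectory started in $x_t = x$
  and driven by the controls \<open>v t, v (t + 1), \<dots>\<close>.\<close>

primrec rollout ::
  "(nat \<Rightarrow> real^'n^'n) \<Rightarrow> (nat \<Rightarrow> real^'m^'n) \<Rightarrow> nat \<Rightarrow> real^'n \<Rightarrow> (nat \<Rightarrow> real^'m)
    \<Rightarrow> nat \<Rightarrow> real^'n" where
  "rollout A B t x v 0 = x"
| "rollout A B t x v (Suc j) = A (t + j) *v rollout A B t x v j + B (t + j) *v v (t + j)"

definition path_weight ::
  "(nat \<Rightarrow> real^'n^'n) \<Rightarrow> (nat \<Rightarrow> real^'m^'n) \<Rightarrow> (nat \<Rightarrow> real^'n^'n) \<Rightarrow> real \<Rightarrow> nat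
    \<Rightarrow> nat \<Rightarrow> real^'n \<Rightarrow> (nat \<Rightarrow> real^'m) \<Rightarrow> real" where
  "path_weight A B M lam T t x v =
    exp (- (1 / lam) * (\<Sum>k=t..T.
      1 / 2 * (rollout A B t x v (k - t) \<bullet> (M k *v rollout A B t x v (k - t)))))"

text \<open>In the next three definitions \<open>r i\<close> is the weight of the \<open>i\<close>-th sampled trajectory and
  \<open>u i\<close> its first control.\<close>

definition emp_r :: "nat \<Rightarrow> (nat \<Rightarrow> real) \<Rightarrow> real" where
  "emp_r n r = 1 / real n * (\<Sum>i<n. r i)"

definition emp_ru :: "nat \<Rightarrow> (nat \<Rightarrow> real) \<Rightarrow> (nat \<Rightarrow> real^'m) \<Rightarrow> real^'m" where
  "emp_ru n r u = (1 / real n) *\<^sub>R (\<Sum>i<n. r i *\<^sub>R u i)"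

definition path_integral_control :: "nat \<Rightarrow> (nat \<Rightarrow> real) \<Rightarrow> (nat \<Rightarrow> real^'m) \<Rightarrow> real^'m" where
  "path_integral_control n r u = (\<Sum>i<n. (r i / (\<Sum>j<n. r j)) *\<^sub>R u i)"

text \<open>The independent sources of randomness: the initial state, the disturbance at time \<open>t\<close>, and
  the control at time \<open>k\<close> in the \<open>i\<close>-th trajectory sampled at time \<open>t\<close>
  (\<open>Sample t i k\<close>). They take values in different spaces, so their independence is
  stated through the sigma-algebras they generate.\<close>

datatype source = Init | Disturbance nat | Sample nat nat nat

definition source_indices :: "nat \<Rightarrow> (nat \<Rightarrow> nat) \<Rightarrow> source set" where
  "source_indices T n =
    {Init} \<union> {Disturbance t |t. t < T} \<union> {Sample t i k |t i k. t < T \<and> i < n t \<and> t \<le> k \<and> k < T}"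

definition generated_events :: "'w measure \<Rightarrow> ('w \<Rightarrow> 'b::topological_space) \<Rightarrow> 'w set set" where
  "generated_events P Y = {Y -` S \<inter> space P |S. S \<in> sets borel}"

definition source_events ::
  "'w measure \<Rightarrow> ('w \<Rightarrow> real^'n) \<Rightarrow> (nat \<Rightarrow> 'w \<Rightarrow> real^'n) \<Rightarrow> (nat \<Rightarrow> nat \<Rightarrow> nat \<Rightarrow> 'w \<Rightarrow> real^'m)
    \<Rightarrow> source \<Rightarrow> 'w set set" where
  "source_events P X0 W V s = (case s of
      Init \<Rightarrow> generated_events P X0
    | Disturbance t \<Rightarrow> generated_events P (W t)
    | Sample t i k \<Rightarrow> generated_events P (V t i k))"

end

theory Submission
  imports Defs
begin

text \<open>
  Reweighted by the path weight \<open>r\<close>, the first control of a sampled trajectory is Gaussian: by the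
  Riccati recursion its mean is the optimal input \<open>K x\<close>, and its covariance is at most the
  original one. Hence \<open>Z = r (u - K x)\<close> is centred, and since \<open>0 < r \<le> 1\<close>, convexity of the
  exponential gives \<open>E exp (l \<bullet> Z) \<le> 1 - E r + E (r exp (l \<bullet> (u - K x))) \<le> exp (l \<bullet> S l / 2)\<close>
  with \<open>S\<close> the covariance of \<open>u\<close>: no loss in the sub-Gaussian parameter. The current state is
  independent of the current samples, so a Chernoff bound controls \<open>\<Sum>i. Z i\<close> outside an event of
  probability \<open>\<beta> t\<close>. The control error equals \<open>\<Sum>i. Z i\<close> divided by the observed \<open>\<Sum>i. r i\<close>, so
  the deviation of \<open>\<Sum>i. r i\<close> from its mean never enters.
\<close>

subsection \<open>Completing the square in the Riccati recursion\<close>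

text \<open>The assumption \<open>N = lam *\<^sub>R matrix_inv \<Omega>hat\<close> ties the sampling
  law to the control problem: a sampled control has density proportional to
  \<open>exp (- v \<bullet> N v / (2 lam))\<close>, so multiplying by the path weight gives
  \<open>exp\<close> of minus the whole cost over \<open>lam\<close>. Completing the square one step
  at a time leaves a Gaussian in the control with precision
  \<open>(B^T \<Theta> B + N) / lam\<close>; this dominates \<open>N / lam\<close>, which is why the
  covariance can only shrink. The normalising factors are free of the state and are compared, never
  computed, so no determinant appears. The obstacle is feedback: the state at time \<open>t\<close>
  depends on all earlier samples. The moment bound is therefore proved for each fixed state, with a
  right-hand side free of the state, and only then is the random state inserted by Fubini. The
  sample-size condition involves observed averages, so it is treated outcome by outcome outside the
  exceptional event, without conditioning. Exponential moments are kept as integrals of nonnegative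
  functions, which avoids integrability questions.\<close>

lemma inner_matrix_vector_transpose:
  fixes A :: "real^'n^'m"
  shows "x \<bullet> (A *v y) = (transpose A *v x) \<bullet> y"
  by (simp add: transpose_matrix_vector dot_lmul_matrix)

lemma inner_vector_matrix_mult:
  fixes A :: "real^'n^'m"
  shows "x \<bullet> (y v* A) = (A *v x) \<bullet> y"
  by (metis dot_lmul_matrix inner_commute)

lemma symmetric_matrix_inner:
  fixes S :: "real^'n^'n"
  assumes "transpose S = S"
  shows "(S *v x) \<bullet> y = x \<bullet> (S *v y)"
  by (simp add: inner_matrix_vector_transpose assms)

lemma matrix_inv_inverse:
  fixes S :: "real^'n^'n"
  assumes "invertible S"
  shows "S ** matrix_inv S = mat 1" "matrix_inv S ** S = mat 1"
proof -
  have "S ** matrix_inv S = mat 1 \<and> matrix_inv S ** S = mat 1"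
    using assms unfolding invertible_def matrix_inv_def by (rule someI_ex)
  then show "S ** matrix_inv S = mat 1" "matrix_inv S ** S = mat 1" by auto
qed

lemma pos_definite_invertible:
  assumes "pos_definite S"
  shows "invertible S"
proof -
  have "x = 0" if "S *v x = 0" for x
    using assms that unfolding pos_definite_def by (metis inner_zero_right less_irrefl)
  then show ?thesis
    unfolding invertible_left_inverse matrix_left_invertible_ker by blast
qed

lemma matrix_inv_symmetric:
  fixes S :: "real^'n^'n"
  assumes "invertible S" "transpose S = S"
  shows "transpose (matrix_inv S) = matrix_inv S"
proof -
  have "transpose (matrix_inv S) ** S = mat 1"
    using matrix_inv_inverse(1)[OF assms(1)] assms(2) by (metis matrix_transpose_mul transpose_mat)
  then show ?thesis
    by (metis assms(1) matrix_inv_inverse(1) matrix_mul_assoc matrix_mul_lid matrix_mul_rid)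
qed

lemma square_root_factor_invertible:
  fixes L :: "real^'n^'n"
  assumes "pos_definite S" "L ** transpose L = S"
  shows "invertible L"
  using pos_definite_invertible[OF assms(1)] assms(2)
  by (metis invertible_right_inverse matrix_inv_inverse(1) matrix_mul_assoc)

text \<open>In the coordinates \<open>v = L z\<close> the inverse covariance becomes
  \<open>L^T S^-1 L\<close>, the identity. This identifies the exponent of the standard normal
  density with the control cost.\<close>

lemma matrix_inv_congruence:
  fixes L :: "real^'n^'n"
  assumes "pos_definite S" "L ** transpose L = S"
  shows "(L *v z) \<bullet> (matrix_inv S *v (L *v z)) = z \<bullet> z"
proof -
  have L: "invertible L" using assms by (rule square_root_factor_invertible)
  have S: "invertible S" using assms(1) by (rule pos_definite_invertible)
  have "L ** (transpose L ** matrix_inv S ** L) = L"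
    using matrix_inv_inverse(1)[OF S] assms(2) by (simp add: matrix_mul_assoc)
  then have "transpose L ** matrix_inv S ** L = mat 1"
    by (metis L matrix_inv_inverse(2) matrix_mul_assoc matrix_mul_lid)
  then have "transpose L *v (matrix_inv S *v (L *v z)) = z"
    by (metis matrix_vector_mul_assoc matrix_vector_mul_lid)
  then show ?thesis
    by (metis inner_commute inner_matrix_vector_transpose)
qed

definition pos_semidefinite :: "real^'n^'n \<Rightarrow> bool" where
  "pos_semidefinite S \<longleftrightarrow> transpose S = S \<and> (\<forall>x. 0 \<le> x \<bullet> (S *v x))"

lemma pos_definite_imp_semidefinite: "pos_definite S \<Longrightarrow> pos_semidefinite S"
  unfolding pos_definite_def pos_semidefinite_def by (metis inner_zero_left less_eq_real_def)

lemma pos_semidefinite_congruence: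
  fixes B :: "real^'m^'n"
  assumes "pos_semidefinite \<Theta>"
  shows "pos_semidefinite (transpose B ** \<Theta> ** B)"
proof -
  have "0 \<le> x \<bullet> ((transpose B ** \<Theta> ** B) *v x)" for x
  proof -
    have "x \<bullet> ((transpose B ** \<Theta> ** B) *v x) = (B *v x) \<bullet> (\<Theta> *v (B *v x))"
      by (simp add: matrix_vector_mul_assoc[symmetric] inner_vector_matrix_mult)
    then show ?thesis using assms by (simp add: pos_semidefinite_def)
  qed
  moreover have "transpose (transpose B ** \<Theta> ** B) = transpose B ** \<Theta> ** B"
    using assms by (simp add: pos_semidefinite_def matrix_transpose_mul matrix_mul_assoc)
  ultimately show ?thesis by (simp add: pos_semidefinite_def)
qed

lemma transpose_add: "transpose (A + B) = transpose A + transpose (B :: real^'n^'m)"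
  by (simp add: transpose_def vec_eq_iff)

lemma transpose_diff: "transpose (A - B) = transpose A - transpose (B :: real^'n^'m)"
  by (simp add: transpose_def vec_eq_iff)

lemma pos_definite_add:
  assumes "pos_semidefinite Q" "pos_definite N"
  shows "pos_definite (Q + N)"
  using assms unfolding pos_definite_def pos_semidefinite_def
  by (simp add: transpose_add matrix_vector_mult_add_rdistrib inner_add_right add_nonneg_pos)

lemma matrix_vector_mult_uminus: "(- A) *v x = - (A *v (x :: real^'n))" for A :: "real^'n^'m"
  by (simp add: matrix_vector_mult_def vec_eq_iff sum_negf)

text \<open>The Hessian in the control of half the one-step cost; divided by \<open>lam\<close> it
  is the precision of the reweighted control.\<close>

definition riccati_S :: "real^'n^'n \<Rightarrow> real^'m^'n \<Rightarrow> real^'m^'m \<Rightarrow> real^'m^'m" where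
  "riccati_S \<Theta> B N = transpose B ** \<Theta> ** B + N"

definition riccati_K ::
  "real^'n^'n \<Rightarrow> real^'n^'n \<Rightarrow> real^'m^'n \<Rightarrow> real^'m^'m \<Rightarrow> real^'n^'m" where
  "riccati_K A \<Theta> B N = - (matrix_inv (riccati_S \<Theta> B N) ** transpose B ** \<Theta> ** A)"

text \<open>The Schur complement that remains after minimising over the control. The stage cost
  \<open>M\<close> is kept apart because it enters the path weight as a factor free of the
  control.\<close>

definition riccati_R ::
  "real^'n^'n \<Rightarrow> real^'n^'n \<Rightarrow> real^'m^'n \<Rightarrow> real^'m^'m \<Rightarrow> real^'n^'n" where
  "riccati_R A \<Theta> B N = transpose A ** \<Theta> ** A
     - transpose A ** \<Theta> ** B ** matrix_inv (riccati_S \<Theta> B N) ** transpose B ** \<Theta> ** A"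

context
  fixes A \<Theta> :: "real^'n^'n" and B :: "real^'m^'n" and N :: "real^'m^'m"
  assumes \<Theta>: "pos_semidefinite \<Theta>" and N: "pos_definite N"
begin

lemma pos_definite_riccati_S: "pos_definite (riccati_S \<Theta> B N)"
  unfolding riccati_S_def by (intro pos_definite_add pos_semidefinite_congruence \<Theta> N)

text \<open>The left side is quadratic in \<open>v\<close>; its minimiser is \<open>K x\<close> and
  its minimal value is the form of the Schur complement. The identity serves twice: for positivity
  of the recursion and for the exponent of the Gaussian integral.\<close>

lemma riccati_complete_square:
  "v \<bullet> (N *v v) + (A *v x + B *v v) \<bullet> (\<Theta> *v (A *v x + B *v v))
    = (v - riccati_K A \<Theta> B N *v x) \<bullet> (riccati_S \<Theta> B N *v (v - riccati_K A \<Theta> B N *v x)) + x \<bullet> (riccati_R A \<Theta> B N *v x)"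
proof -
  define y where "y = A *v x"
  define k where "k = riccati_K A \<Theta> B N *v x"
  \<comment> \<open>Half the gradient in \<open>v\<close> at \<open>v = 0\<close>; stationarity of
    the minimiser then reads \<open>S k = - g\<close>.\<close>
  define g where "g = transpose B *v (\<Theta> *v y)"
  have sym\<Theta>: "transpose \<Theta> = \<Theta>" using \<Theta> by (simp add: pos_semidefinite_def)
  have symS: "transpose (riccati_S \<Theta> B N) = riccati_S \<Theta> B N"
    using pos_definite_riccati_S by (simp add: pos_definite_def)
  have inv: "invertible (riccati_S \<Theta> B N)" by (rule pos_definite_invertible[OF pos_definite_riccati_S])
  have k: "k = - (matrix_inv (riccati_S \<Theta> B N) *v g)"
    unfolding k_def riccati_K_def g_def y_def
    by (simp add: matrix_vector_mult_uminus matrix_vector_mul_assoc matrix_mul_assoc)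
  have "riccati_S \<Theta> B N *v (matrix_inv (riccati_S \<Theta> B N) *v g) = g"
    by (simp add: matrix_vector_mul_assoc matrix_inv_inverse[OF inv])
  then have Sk: "riccati_S \<Theta> B N *v k = - g"
    unfolding k by (simp add: linear_neg[OF matrix_vector_mul_linear])
  have cross: "w \<bullet> g = (B *v w) \<bullet> (\<Theta> *v y)" for w
    unfolding g_def by (simp add: inner_vector_matrix_mult)
  have R: "x \<bullet> (riccati_R A \<Theta> B N *v x) = y \<bullet> (\<Theta> *v y) + g \<bullet> k"
  proof -
    have "riccati_R A \<Theta> B N *v x = transpose A *v (\<Theta> *v y) + transpose A *v (\<Theta> *v (B *v k))"
      unfolding riccati_R_def k g_def y_def
      by (simp add: matrix_vector_mult_diff_rdistrib matrix_vector_mul_assoc matrix_mul_assoc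
          linear_neg[OF matrix_vector_mul_linear])
    then have "x \<bullet> (riccati_R A \<Theta> B N *v x) = y \<bullet> (\<Theta> *v y) + y \<bullet> (\<Theta> *v (B *v k))"
      by (simp add: inner_add_right inner_vector_matrix_mult y_def)
    moreover have "y \<bullet> (\<Theta> *v (B *v k)) = g \<bullet> k"
      using cross[of k] by (metis inner_commute sym\<Theta> symmetric_matrix_inner)
    ultimately show ?thesis by simp
  qed
  have S: "v \<bullet> (riccati_S \<Theta> B N *v v) = v \<bullet> (N *v v) + (B *v v) \<bullet> (\<Theta> *v (B *v v))"
    unfolding riccati_S_def
    by (simp add: matrix_vector_mult_add_rdistrib matrix_vector_mul_assoc[symmetric] inner_add_right
        inner_vector_matrix_mult)
  have "k \<bullet> (riccati_S \<Theta> B N *v v) = - (v \<bullet> g)"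
    using symmetric_matrix_inner[OF symS, of k v] Sk by (simp add: inner_commute)
  then have "(v - k) \<bullet> (riccati_S \<Theta> B N *v (v - k)) = v \<bullet> (riccati_S \<Theta> B N *v v) + 2 * (v \<bullet> g) - g \<bullet> k"
    using Sk by (simp add: matrix_vector_mult_diff_distrib inner_diff_left inner_diff_right
        inner_add_right inner_commute)
  moreover have "(y + B *v v) \<bullet> (\<Theta> *v (y + B *v v))
      = y \<bullet> (\<Theta> *v y) + 2 * (v \<bullet> g) + (B *v v) \<bullet> (\<Theta> *v (B *v v))"
    using cross[of v] symmetric_matrix_inner[OF sym\<Theta>, of "B *v v" y]
    by (simp add: matrix_vector_right_distrib inner_add_left inner_add_right inner_commute)
  ultimately show ?thesis
    using R S unfolding y_def k_def by simp
qed

text \<open>At \<open>v = K x\<close> the square vanishes, so the remaining form equals a one-step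
  cost, which is nonnegative.\<close>

lemma pos_semidefinite_riccati_R: "pos_semidefinite (riccati_R A \<Theta> B N)"
proof -
  have "0 \<le> x \<bullet> (riccati_R A \<Theta> B N *v x)" for x
    using riccati_complete_square[of "riccati_K A \<Theta> B N *v x" x] \<Theta> pos_definite_imp_semidefinite[OF N]
    unfolding pos_semidefinite_def by (simp add: add_nonneg_nonneg) (metis add_nonneg_nonneg)
  moreover have "transpose (matrix_inv (riccati_S \<Theta> B N)) = matrix_inv (riccati_S \<Theta> B N)"
    using pos_definite_riccati_S matrix_inv_symmetric pos_definite_invertible
    unfolding pos_definite_def by blast
  then have "transpose (riccati_R A \<Theta> B N) = riccati_R A \<Theta> B N"
    using \<Theta> unfolding riccati_R_def pos_semidefinite_def
    by (simp add: transpose_diff matrix_transpose_mul matrix_mul_assoc)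
  ultimately show ?thesis by (simp add: pos_semidefinite_def)
qed

end

text \<open>Returns from steps counted from the horizon to forward time; \<open>t < T\<close> keeps
  the truncated differences \<open>T - t\<close> and \<open>T - Suc t\<close> one apart.\<close>

lemma riccati_Suc:
  assumes "t < T"
  shows "riccati A B M N T (T - t) =
    riccati_R (A t) (riccati A B M N T (T - Suc t)) (B t) (N t) + M t"
proof -
  have *: "T - t = Suc (T - Suc t)" "T - Suc (T - Suc t) = t" using assms by simp_all
  show ?thesis
    unfolding *(1) riccati.simps *(2) Let_def riccati_R_def riccati_S_def
    by simp
qed

lemma lqr_gain_eq_riccati_K:
  "lqr_gain A B M N T t = riccati_K (A t) (riccati A B M N T (T - Suc t)) (B t) (N t)"
  unfolding lqr_gain_def riccati_K_def riccati_S_def Let_def ..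

lemma pos_semidefinite_riccati:
  assumes "\<And>t. t \<le> T \<Longrightarrow> pos_definite (M t)" "\<And>t. t < T \<Longrightarrow> pos_definite (N t)" "t \<le> T"
  shows "pos_semidefinite (riccati A B M N T (T - t))"
  using assms(3)
proof (induction rule: inc_induct)
  case base
  then show ?case using assms(1) by (simp add: pos_definite_imp_semidefinite)
next
  case (step t)
  show ?case
    unfolding riccati_Suc[OF step(2)]
    by (intro pos_definite_imp_semidefinite pos_definite_add pos_semidefinite_riccati_R step assms)
       (use step in auto)
qed

subsection \<open>Gaussian integrals\<close>

lemma borel_measurable_matrix_vector_mult [measurable (raw)]:
  fixes A :: "real^'n^'m"
  assumes "f \<in> borel_measurable F"
  shows "(\<lambda>\<omega>. A *v f \<omega>) \<in> borel_measurable F"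
  using assms
  by (rule measurable_compose) (intro borel_measurable_continuous_onI matrix_vector_mult_linear_continuous_on)

lemma nn_integral_lborel_translate:
  fixes f :: "'a::euclidean_space \<Rightarrow> ennreal"
  assumes [measurable]: "f \<in> borel_measurable borel"
  shows "(\<integral>\<^sup>+z. f (z - c) \<partial>lborel) = (\<integral>\<^sup>+z. f z \<partial>lborel)"
proof -
  have "(\<integral>\<^sup>+z. f z \<partial>lborel) = (\<integral>\<^sup>+z. f z \<partial>distr lborel borel ((+) (- c)))"
    by (simp add: lborel_distr_plus)
  then show ?thesis by (simp add: nn_integral_distr)
qed

text \<open>A Gaussian with precision at least the identity has exponential moments no larger than
  the standard one. Both sides carry the same unevaluated normalising integral: shifting by
  \<open>w = Q^-1 b\<close> turns the linear term into the factor
  \<open>exp (w \<bullet> b / 2)\<close>.\<close>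

lemma gaussian_integral_tilt:
  fixes Q :: "real^'m^'m"
  assumes "pos_definite Q" and Q: "\<And>z. z \<bullet> z \<le> z \<bullet> (Q *v z)"
  shows "(\<integral>\<^sup>+z. ennreal (exp (b \<bullet> z - z \<bullet> (Q *v z) / 2)) \<partial>lborel)
    \<le> ennreal (exp (b \<bullet> b / 2)) * (\<integral>\<^sup>+z. ennreal (exp (- (z \<bullet> (Q *v z) / 2))) \<partial>lborel)"
proof -
  have sym: "transpose Q = Q" using assms(1) by (simp add: pos_definite_def)
  define w where "w = matrix_inv Q *v b"
  have w: "Q *v w = b"
    unfolding w_def
    by (simp add: matrix_vector_mul_assoc matrix_inv_inverse pos_definite_invertible[OF assms(1)])
  \<comment> \<open>Expanding this square and using
    \<open>w \<bullet> w \<le> w \<bullet> Q w = w \<bullet> b\<close> gives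
    \<open>w \<bullet> b \<le> b \<bullet> b\<close>, which replaces an appeal to antitonicity of
    matrix inversion.\<close>
  have "0 \<le> (b - w) \<bullet> (b - w)" by simp
  also have "\<dots> = b \<bullet> b - 2 * (w \<bullet> b) + w \<bullet> w"
    by (simp add: inner_diff_left inner_diff_right inner_commute)
  finally have wb: "w \<bullet> b \<le> b \<bullet> b" using Q[of w] w by simp
  have "b \<bullet> z - z \<bullet> (Q *v z) / 2 = w \<bullet> b / 2 - (z - w) \<bullet> (Q *v (z - w)) / 2" for z
    using symmetric_matrix_inner[OF sym, of w z] w
    by (simp add: matrix_vector_mult_diff_distrib inner_diff_left inner_diff_right
        inner_commute diff_divide_distrib add_divide_distrib algebra_simps)
  then have "(\<integral>\<^sup>+z. ennreal (exp (b \<bullet> z - z \<bullet> (Q *v z) / 2)) \<partial>lborel)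
      = (\<integral>\<^sup>+z. ennreal (exp (w \<bullet> b / 2)) * ennreal (exp (- ((z - w) \<bullet> (Q *v (z - w)) / 2))) \<partial>lborel)"
    by (intro nn_integral_cong) (simp add: ennreal_mult'[symmetric] exp_add[symmetric])
  also have "\<dots> = ennreal (exp (w \<bullet> b / 2)) * (\<integral>\<^sup>+z. ennreal (exp (- ((z - w) \<bullet> (Q *v (z - w)) / 2))) \<partial>lborel)"
    by (rule nn_integral_cmult) simp
  also have "\<dots> = ennreal (exp (w \<bullet> b / 2)) * (\<integral>\<^sup>+z. ennreal (exp (- (z \<bullet> (Q *v z) / 2))) \<partial>lborel)"
    by (subst nn_integral_lborel_translate[where f="\<lambda>z. ennreal (exp (- (z \<bullet> (Q *v z) / 2)))"]) simp_all
  also have "\<dots> \<le> ennreal (exp (b \<bullet> b / 2)) * (\<integral>\<^sup>+z. ennreal (exp (- (z \<bullet> (Q *v z) / 2))) \<partial>lborel)"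
    using wb by (intro mult_right_mono ennreal_leI) simp_all
  finally show ?thesis .
qed

lemma prod_std_normal_density:
  "(\<Prod>i\<in>UNIV. std_normal_density ((z :: real^'n) $ i))
    = (1 / sqrt (2 * pi)) ^ CARD('n) * exp (- (z \<bullet> z / 2))"
  unfolding std_normal_density_def
  by (simp add: prod_dividef power_divide exp_sum[symmetric] inner_vec_def power2_eq_square sum_negf
      sum_divide_distrib)

text \<open>The exponentiated cost-to-go \<open>exp (- V x / lam)\<close> of the value function
  \<open>V x = x \<bullet> \<Theta> x / 2\<close>. Under this transform the Bellman recursion
  becomes Gaussian integration over the sampled control.\<close>

definition quadratic_weight :: "real \<Rightarrow> real^'n^'n \<Rightarrow> real^'n \<Rightarrow> real" where
  "quadratic_weight lam \<Theta> x = exp (- (1 / (2 * lam)) * (x \<bullet> (\<Theta> *v x)))"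

lemma quadratic_weight_add:
  "quadratic_weight lam (R + M) x = quadratic_weight lam R x * quadratic_weight lam M x"
  by (simp add: quadratic_weight_def matrix_vector_mult_add_rdistrib inner_add_right
      exp_add[symmetric] algebra_simps)

lemma borel_measurable_quadratic_weight [measurable (raw)]:
  assumes [measurable]: "f \<in> borel_measurable F"
  shows "(\<lambda>\<omega>. quadratic_weight lam \<Theta> (f \<omega>)) \<in> borel_measurable F"
  unfolding quadratic_weight_def by measurable

text \<open>Under the Gaussian law reweighted by \<open>quadratic_weight\<close> the control is Gaussian with mean
  \<open>riccati_K *v x\<close> and covariance at most \<open>S\<close>.\<close>

lemma gaussian_riccati_step:
  fixes A \<Theta> :: "real^'n^'n" and B :: "real^'m^'n" and N S L :: "real^'m^'m"
  assumes \<Theta>: "pos_semidefinite \<Theta>" and N: "pos_definite N" and S: "pos_definite S"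
    and lam: "0 < lam" and NS: "N = lam *\<^sub>R matrix_inv S" and LS: "L ** transpose L = S"
    and \<mu>: "\<mu> = distr std_normal_vec borel ((*v) L)"
  obtains C :: "real^'m \<Rightarrow> ennreal" where
    "\<And>x l. (\<integral>\<^sup>+v. ennreal (exp (l \<bullet> (v - riccati_K A \<Theta> B N *v x)) * quadratic_weight lam \<Theta> (A *v x + B *v v)) \<partial>\<mu>)
        = C l * ennreal (quadratic_weight lam (riccati_R A \<Theta> B N) x)"
    "\<And>l. C l \<le> ennreal (exp (l \<bullet> (S *v l) / 2)) * C 0"
proof -
  define c where "c = (1 / sqrt (2 * pi)) ^ CARD('m)"
  have c: "0 \<le> c" by (simp add: c_def)
  define K where "K = riccati_K A \<Theta> B N"
  define R where "R = riccati_R A \<Theta> B N"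
  \<comment> \<open>The precision of the reweighted control in the coordinates
    \<open>v = L z\<close>.\<close>
  define Q where "Q = (1 / lam) *\<^sub>R (transpose L ** riccati_S \<Theta> B N ** L)"
  have invL: "invertible L" using S LS by (rule square_root_factor_invertible)
  have sqN: "(L *v z) \<bullet> (N *v (L *v z)) = lam * (z \<bullet> z)" for z
    unfolding NS using matrix_inv_congruence[OF S LS, of z]
    by (simp add: scaleR_matrix_vector_assoc[symmetric])
  have Qz: "z \<bullet> (Q *v z) = (1 / lam) * ((L *v z) \<bullet> (riccati_S \<Theta> B N *v (L *v z)))" for z
    unfolding Q_def
    by (simp add: scaleR_matrix_vector_assoc[symmetric] matrix_vector_mul_assoc[symmetric]
        inner_vector_matrix_mult)
  \<comment> \<open>The \<open>N\<close> part of \<open>riccati_S\<close> contributes exactly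
    \<open>z \<bullet> z\<close>, and the \<open>\<Theta>\<close> part is nonnegative.\<close>
  have Q: "z \<bullet> z \<le> z \<bullet> (Q *v z)" for z
  proof -
    have "(L *v z) \<bullet> (riccati_S \<Theta> B N *v (L *v z))
        = (B *v (L *v z)) \<bullet> (\<Theta> *v (B *v (L *v z))) + lam * (z \<bullet> z)"
      unfolding riccati_S_def
      by (simp add: matrix_vector_mult_add_rdistrib matrix_vector_mul_assoc[symmetric] inner_add_right
        inner_vector_matrix_mult sqN)
    moreover have "0 \<le> (B *v (L *v z)) \<bullet> (\<Theta> *v (B *v (L *v z)))"
      using \<Theta> by (simp add: pos_semidefinite_def)
    ultimately show ?thesis using lam by (simp add: Qz field_simps)
  qed
  have symQ: "transpose Q = Q"
    using pos_definite_riccati_S[OF \<Theta> N, of B] unfolding Q_def pos_definite_def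
    by (simp add: transpose_scalar matrix_transpose_mul matrix_mul_assoc)
  have pdQ: "pos_definite Q"
    unfolding pos_definite_def using symQ Q by (metis inner_gt_zero_iff less_le_trans)
  \<comment> \<open>After recentring, the state survives only in
    \<open>quadratic_weight lam R x\<close>, so this factor depends on \<open>l\<close>
    alone.\<close>
  define C where "C l = (\<integral>\<^sup>+z. ennreal (c * exp ((transpose L *v l) \<bullet> z - z \<bullet> (Q *v z) / 2)) \<partial>lborel)" for l
  have C: "C l = ennreal c * (\<integral>\<^sup>+z. ennreal (exp ((transpose L *v l) \<bullet> z - z \<bullet> (Q *v z) / 2)) \<partial>lborel)" for l
    unfolding C_def using c by (simp add: ennreal_mult' nn_integral_cmult)
  have le: "C l \<le> ennreal (exp (l \<bullet> (S *v l) / 2)) * C 0" for l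
  proof -
    have "(transpose L *v l) \<bullet> (transpose L *v l) = l \<bullet> (S *v l)"
      using LS by (metis inner_matrix_vector_transpose matrix_vector_mul_assoc transpose_transpose)
    with gaussian_integral_tilt[OF pdQ Q, of "transpose L *v l"]
    have "ennreal c * (\<integral>\<^sup>+z. ennreal (exp ((transpose L *v l) \<bullet> z - z \<bullet> (Q *v z) / 2)) \<partial>lborel)
      \<le> ennreal c * (ennreal (exp (l \<bullet> (S *v l) / 2)) * (\<integral>\<^sup>+z. ennreal (exp (- (z \<bullet> (Q *v z) / 2))) \<partial>lborel))"
      by (intro mult_left_mono) simp_all
    then show ?thesis by (simp add: C mult.left_commute)
  qed
  have eq: "(\<integral>\<^sup>+v. ennreal (exp (l \<bullet> (v - K *v x)) * quadratic_weight lam \<Theta> (A *v x + B *v v)) \<partial>\<mu>)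
        = C l * ennreal (quadratic_weight lam R x)" for x l
  proof -
    \<comment> \<open>The optimal input \<open>K x\<close> pulled back through
      \<open>v = L z\<close>; it is the mean of the reweighted \<open>z\<close>.\<close>
    define k where "k = matrix_inv L *v (K *v x)"
    have Lk: "K *v x = L *v k"
      unfolding k_def by (metis invL matrix_inv_inverse(1) matrix_vector_mul_assoc matrix_vector_mul_lid)
    \<comment> \<open>The term \<open>- z \<bullet> z / 2\<close> of the sampling density supplies
      the missing control cost \<open>- v \<bullet> N v / (2 lam)\<close>, so that the square can be
      completed.\<close>
    have expo: "- (z \<bullet> z / 2) + (l \<bullet> (L *v z - K *v x)
          + - (1 / (2 * lam)) * ((A *v x + B *v (L *v z)) \<bullet> (\<Theta> *v (A *v x + B *v (L *v z)))))
        = ((transpose L *v l) \<bullet> (z - k) - (z - k) \<bullet> (Q *v (z - k)) / 2)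
          + - (1 / (2 * lam)) * (x \<bullet> (R *v x))" (is "?lhs = ?rhs") for z
    proof -
      have "(A *v x + B *v (L *v z)) \<bullet> (\<Theta> *v (A *v x + B *v (L *v z)))
          = lam * ((z - k) \<bullet> (Q *v (z - k))) + x \<bullet> (R *v x) - lam * (z \<bullet> z)"
        using riccati_complete_square[OF \<Theta> N, of "L *v z" A x B] lam sqN[of z]
        unfolding K_def[symmetric] R_def[symmetric] Lk Qz
        by (simp add: matrix_vector_mult_diff_distrib)
      moreover have "(transpose L *v l) \<bullet> (z - k) = l \<bullet> (L *v z - K *v x)"
        by (simp only: inner_matrix_vector_transpose[symmetric] Lk matrix_vector_mult_diff_distrib)
      ultimately show ?thesis using lam by (simp add: field_simps)
    qed
    have "(\<integral>\<^sup>+v. ennreal (exp (l \<bullet> (v - K *v x)) * quadratic_weight lam \<Theta> (A *v x + B *v v)) \<partial>\<mu>)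
      = (\<integral>\<^sup>+z. ennreal (c * exp (- (z \<bullet> z / 2)))
          * ennreal (exp (l \<bullet> (L *v z - K *v x)) * quadratic_weight lam \<Theta> (A *v x + B *v (L *v z))) \<partial>lborel)"
      unfolding \<mu> std_normal_vec_def prod_std_normal_density c_def[symmetric]
      by (simp add: nn_integral_distr nn_integral_density)
    also have "\<dots> = (\<integral>\<^sup>+z. ennreal (c * exp ((transpose L *v l) \<bullet> (z - k) - (z - k) \<bullet> (Q *v (z - k)) / 2))
          * ennreal (quadratic_weight lam R x) \<partial>lborel)"
    proof (rule nn_integral_cong)
      fix z :: "real^'m"
      have "exp (- (z \<bullet> z / 2)) * (exp (l \<bullet> (L *v z - K *v x)) * quadratic_weight lam \<Theta> (A *v x + B *v (L *v z)))
        = exp ((transpose L *v l) \<bullet> (z - k) - (z - k) \<bullet> (Q *v (z - k)) / 2) * quadratic_weight lam R x"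
        unfolding quadratic_weight_def exp_add[symmetric] expo ..
      then show "ennreal (c * exp (- (z \<bullet> z / 2)))
          * ennreal (exp (l \<bullet> (L *v z - K *v x)) * quadratic_weight lam \<Theta> (A *v x + B *v (L *v z)))
        = ennreal (c * exp ((transpose L *v l) \<bullet> (z - k) - (z - k) \<bullet> (Q *v (z - k)) / 2))
          * ennreal (quadratic_weight lam R x)"
        using c by (simp add: ennreal_mult'[symmetric] mult.assoc quadratic_weight_def)
    qed
    also have "\<dots> = C l * ennreal (quadratic_weight lam R x)"
      unfolding C_def
      by (subst nn_integral_multc, measurable)
         (subst nn_integral_lborel_translate[where
            f="\<lambda>z. ennreal (c * exp ((transpose L *v l) \<bullet> z - z \<bullet> (Q *v z) / 2))"], simp_all)
    finally show ?thesis .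
  qed
  show thesis
    using that[of C] eq le unfolding K_def R_def by blast
qed

subsection \<open>Path weights\<close>

text \<open>\<open>rollout\<close> recurses at the end of the path, whereas the backward induction
  over time removes its first step.\<close>

lemma rollout_Suc_shift:
  "rollout A B t x v (Suc j) = rollout A B (Suc t) (A t *v x + B t *v v t) v j"
  by (induction j) simp_all

lemma rollout_cong:
  "(\<And>k. t \<le> k \<Longrightarrow> k < t + j \<Longrightarrow> v k = w k) \<Longrightarrow> rollout A B t x v j = rollout A B t x w j"
  by (induction j) simp_all

lemma borel_measurable_rollout:
  assumes "f \<in> borel_measurable F" "\<And>k. t \<le> k \<Longrightarrow> k < t + j \<Longrightarrow> (\<lambda>\<omega>. v \<omega> k) \<in> borel_measurable F"
  shows "(\<lambda>\<omega>. rollout A B t (f \<omega>) (v \<omega>) j) \<in> borel_measurable F"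
  using assms(2) by (induction j) (use assms(1) in simp_all)

context
  fixes A :: "nat \<Rightarrow> real^'n^'n" and B :: "nat \<Rightarrow> real^'m^'n" and M :: "nat \<Rightarrow> real^'n^'n"
    and lam :: real and T :: nat
begin

lemma path_weight_cong:
  assumes "\<And>k. t \<le> k \<Longrightarrow> k < T \<Longrightarrow> v k = w k"
  shows "path_weight A B M lam T t x v = path_weight A B M lam T t x w"
proof -
  have "rollout A B t x v (k - t) = rollout A B t x w (k - t)" if "k \<in> {t..T}" for k
    using that assms by (intro rollout_cong) auto
  then show ?thesis unfolding path_weight_def by simp
qed

lemma borel_measurable_path_weight:
  assumes "f \<in> borel_measurable F" "\<And>k. t \<le> k \<Longrightarrow> k < T \<Longrightarrow> (\<lambda>\<omega>. v \<omega> k) \<in> borel_measurable F"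
  shows "(\<lambda>\<omega>. path_weight A B M lam T t (f \<omega>) (v \<omega>)) \<in> borel_measurable F"
proof -
  have [measurable]: "(\<lambda>\<omega>. rollout A B t (f \<omega>) (v \<omega>) (k - t)) \<in> borel_measurable F" if "k \<in> {t..T}" for k
    using that assms by (intro borel_measurable_rollout) auto
  show ?thesis unfolding path_weight_def by measurable
qed

lemma path_weight_pos: "0 < path_weight A B M lam T t x v"
  unfolding path_weight_def by simp

lemma path_weight_le_1:
  assumes "\<And>t. t \<le> T \<Longrightarrow> pos_definite (M t)" "0 < lam"
  shows "path_weight A B M lam T t x v \<le> 1"
proof -
  have "0 \<le> (\<Sum>k=t..T. 1 / 2 * (rollout A B t x v (k - t) \<bullet> (M k *v rollout A B t x v (k - t))))"
    using pos_definite_imp_semidefinite[OF assms(1)] unfolding pos_semidefinite_def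
    by (intro sum_nonneg) simp
  then show ?thesis unfolding path_weight_def using assms(2) by simp
qed

lemma path_weight_step:
  assumes "t < T"
  shows "path_weight A B M lam T t x v
    = quadratic_weight lam (M t) x * path_weight A B M lam T (Suc t) (A t *v x + B t *v v t) v"
proof -
  have "(\<Sum>k=t..T. 1 / 2 * (rollout A B t x v (k - t) \<bullet> (M k *v rollout A B t x v (k - t))))
    = 1 / 2 * (x \<bullet> (M t *v x))
      + (\<Sum>k=Suc t..T. 1 / 2 * (rollout A B t x v (k - t) \<bullet> (M k *v rollout A B t x v (k - t))))"
    using assms by (simp add: sum.atLeast_Suc_atMost)
  also have "(\<Sum>k=Suc t..T. 1 / 2 * (rollout A B t x v (k - t) \<bullet> (M k *v rollout A B t x v (k - t))))
    = (\<Sum>k=Suc t..T. 1 / 2 * (rollout A B (Suc t) (A t *v x + B t *v v t) v (k - Suc t)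
        \<bullet> (M k *v rollout A B (Suc t) (A t *v x + B t *v v t) v (k - Suc t))))"
  proof (rule sum.cong[OF refl])
    fix k assume "k \<in> {Suc t..T}"
    then have "k - t = Suc (k - Suc t)" by auto
    then have "rollout A B t x v (k - t) = rollout A B (Suc t) (A t *v x + B t *v v t) v (k - Suc t)"
      by (simp only: rollout_Suc_shift)
    then show "1 / 2 * (rollout A B t x v (k - t) \<bullet> (M k *v rollout A B t x v (k - t)))
      = 1 / 2 * (rollout A B (Suc t) (A t *v x + B t *v v t) v (k - Suc t)
        \<bullet> (M k *v rollout A B (Suc t) (A t *v x + B t *v v t) v (k - Suc t)))" by simp
  qed
  finally show ?thesis
    unfolding path_weight_def quadratic_weight_def exp_add[symmetric] by (simp only: distrib_left) simp
qed

section \<open>Integrating the path weight over the sampled controls\<close>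

lemma borel_measurable_PiM_component:
  assumes "\<And>k. sets (\<mu> k) = sets borel" "k \<in> I"
  shows "(\<lambda>v. v k) \<in> borel_measurable (PiM I \<mu>)"
  using measurable_component_singleton[OF assms(2), of \<mu>]
  by (simp cong: measurable_cong_sets add: assms(1))

text \<open>Fubini with the control at time \<open>t\<close> outermost: the later part of the path
  sees that control only through the next state, so the inner integral is the same problem started
  one step later.\<close>

lemma nn_integral_path_weight_peel:
  fixes \<mu> :: "nat \<Rightarrow> (real^'m) measure"
  assumes \<mu>: "\<And>k. prob_space (\<mu> k)" "\<And>k. sets (\<mu> k) = sets borel" and t: "t < T"
    and f[measurable]: "f \<in> borel_measurable borel"
  shows "(\<integral>\<^sup>+v. f (v t) * ennreal (path_weight A B M lam T t x v) \<partial>PiM {t..<T} \<mu>)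
    = ennreal (quadratic_weight lam (M t) x) * (\<integral>\<^sup>+y. f y *
        (\<integral>\<^sup>+v. ennreal (path_weight A B M lam T (Suc t) (A t *v x + B t *v y) v) \<partial>PiM {Suc t..<T} \<mu>) \<partial>\<mu> t)"
proof -
  interpret product_prob_space \<mu> UNIV
    by (intro product_prob_spaceI \<mu>)
  note \<mu>(2)[measurable_cong, simp]
  note meas = borel_measurable_PiM_component[of \<mu>, OF \<mu>(2)]
  have int: "(\<lambda>v. path_weight A B M lam T t' (g v) v) \<in> borel_measurable (PiM {t'..<T} \<mu>)"
    if "g \<in> borel_measurable (PiM {t'..<T} \<mu>)" for t' g
    using that by (intro borel_measurable_path_weight meas) simp_all
  have split: "{t..<T} = insert t {Suc t..<T}" using t by auto
  have m1: "(\<lambda>v. f (v t) * ennreal (path_weight A B M lam T t x v)) \<in> borel_measurable (PiM {t..<T} \<mu>)"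
  proof -
    have [measurable]: "(\<lambda>v. v t) \<in> PiM {t..<T} \<mu> \<rightarrow>\<^sub>M borel" using t by (intro meas) simp
    have [measurable]: "(\<lambda>v. path_weight A B M lam T t x v) \<in> borel_measurable (PiM {t..<T} \<mu>)"
      by (rule int) simp
    show ?thesis by measurable
  qed
  have "(\<integral>\<^sup>+v. f (v t) * ennreal (path_weight A B M lam T t x v) \<partial>PiM {t..<T} \<mu>)
    = (\<integral>\<^sup>+y. (\<integral>\<^sup>+v. f y * ennreal (path_weight A B M lam T t x (v(t := y))) \<partial>PiM {Suc t..<T} \<mu>) \<partial>\<mu> t)"
    using m1 unfolding split by (subst product_nn_integral_insert_rev) auto
  also have "\<dots> = (\<integral>\<^sup>+y. ennreal (quadratic_weight lam (M t) x) * (f y *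
        (\<integral>\<^sup>+v. ennreal (path_weight A B M lam T (Suc t) (A t *v x + B t *v y) v) \<partial>PiM {Suc t..<T} \<mu>)) \<partial>\<mu> t)"
  proof (rule nn_integral_cong)
    fix y
    have "path_weight A B M lam T t x (v(t := y)) = quadratic_weight lam (M t) x *
        path_weight A B M lam T (Suc t) (A t *v x + B t *v y) v" for v
      unfolding path_weight_step[OF t] fun_upd_same
      by (intro arg_cong2[where f="(*)"] refl path_weight_cong) auto
    then have "(\<integral>\<^sup>+v. f y * ennreal (path_weight A B M lam T t x (v(t := y))) \<partial>PiM {Suc t..<T} \<mu>)
      = (\<integral>\<^sup>+v. ennreal (quadratic_weight lam (M t) x) * f y *
        ennreal (path_weight A B M lam T (Suc t) (A t *v x + B t *v y) v) \<partial>PiM {Suc t..<T} \<mu>)"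
      by (simp add: ennreal_mult'[OF path_weight_pos[THEN less_imp_le]] quadratic_weight_def ennreal_mult' ac_simps)
    also have "\<dots> = ennreal (quadratic_weight lam (M t) x) * f y *
        (\<integral>\<^sup>+v. ennreal (path_weight A B M lam T (Suc t) (A t *v x + B t *v y) v) \<partial>PiM {Suc t..<T} \<mu>)"
      using int[of "\<lambda>_. A t *v x + B t *v y" "Suc t"] by (intro nn_integral_cmult) simp
    finally show "(\<integral>\<^sup>+v. f y * ennreal (path_weight A B M lam T t x (v(t := y))) \<partial>PiM {Suc t..<T} \<mu>)
      = ennreal (quadratic_weight lam (M t) x) * (f y *
        (\<integral>\<^sup>+v. ennreal (path_weight A B M lam T (Suc t) (A t *v x + B t *v y) v) \<partial>PiM {Suc t..<T} \<mu>))"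
      by (simp add: mult.assoc)
  qed
  also have "\<dots> = ennreal (quadratic_weight lam (M t) x) * (\<integral>\<^sup>+y. f y *
        (\<integral>\<^sup>+v. ennreal (path_weight A B M lam T (Suc t) (A t *v x + B t *v y) v) \<partial>PiM {Suc t..<T} \<mu>) \<partial>\<mu> t)"
  proof (rule nn_integral_cmult)
    have sf: "sigma_finite_measure (PiM {Suc t..<T} \<mu>)" 
      by (intro prob_space_imp_sigma_finite prob_space_PiM \<mu>)
    have "(\<lambda>z. path_weight A B M lam T (Suc t) (A t *v x + B t *v fst z) (snd z))
        \<in> borel_measurable (\<mu> t \<Otimes>\<^sub>M PiM {Suc t..<T} \<mu>)"
    proof (rule borel_measurable_path_weight)
      show "(\<lambda>z. A t *v x + B t *v fst z) \<in> borel_measurable (\<mu> t \<Otimes>\<^sub>M PiM {Suc t..<T} \<mu>)"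
        by measurable
      show "(\<lambda>z. snd z k) \<in> borel_measurable (\<mu> t \<Otimes>\<^sub>M PiM {Suc t..<T} \<mu>)" if "Suc t \<le> k" "k < T" for k
        using that by (intro measurable_compose[OF measurable_snd meas]) simp
    qed
    then have [measurable]: "(\<lambda>y. \<integral>\<^sup>+v. ennreal (path_weight A B M lam T (Suc t) (A t *v x + B t *v y) v) \<partial>PiM {Suc t..<T} \<mu>)
        \<in> borel_measurable (\<mu> t)"
      by (intro sigma_finite_measure.borel_measurable_nn_integral[OF sf]) (simp add: case_prod_beta')
    show "(\<lambda>y. f y * (\<integral>\<^sup>+v. ennreal (path_weight A B M lam T (Suc t) (A t *v x + B t *v y) v) \<partial>PiM {Suc t..<T} \<mu>))
        \<in> borel_measurable (\<mu> t)"
      by measurable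
  qed
  finally show ?thesis .
qed

end

text \<open>The measures \<open>\<mu> k\<close> are required to be Borel probability measures for
  every \<open>k\<close>, as the product space theory expects of a whole family, but Gaussian only
  from the sampling time \<open>t\<^sub>0\<close> up to the horizon. Arbitrary laws may fill the
  other indices.\<close>

locale path_integral_model =
  fixes A M :: "nat \<Rightarrow> real^'n^'n" and B :: "nat \<Rightarrow> real^'m^'n" and N S :: "nat \<Rightarrow> real^'m^'m"
    and lam :: real and t\<^sub>0 T :: nat and \<mu> :: "nat \<Rightarrow> (real^'m) measure"
  assumes M: "\<And>t. t \<le> T \<Longrightarrow> pos_definite (M t)" and N: "\<And>t. t < T \<Longrightarrow> pos_definite (N t)"
    and lam: "0 < lam" and S: "\<And>t. t < T \<Longrightarrow> pos_definite (S t)"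
    and NS: "\<And>t. t < T \<Longrightarrow> N t = lam *\<^sub>R matrix_inv (S t)"
    and prob: "\<And>k. prob_space (\<mu> k)" and sets_\<mu>: "\<And>k. sets (\<mu> k) = sets borel"
    and normal: "\<And>k. t\<^sub>0 \<le> k \<Longrightarrow> k < T \<Longrightarrow> \<exists>L :: real^'m^'m. L ** transpose L = S k \<and> \<mu> k = distr std_normal_vec borel ((*v) L)"
begin

abbreviation "pw \<equiv> path_weight A B M lam T"
abbreviation "\<Theta> t \<equiv> riccati A B M N T (T - t)"

lemma psd_\<Theta>: "t \<le> T \<Longrightarrow> pos_semidefinite (\<Theta> t)"
  using M N by (rule pos_semidefinite_riccati)

text \<open>With \<open>l = 0\<close> this is the induction step for the mean weight; with general
  \<open>l\<close> it yields the moment bound at the sampling time. It is essential that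
  \<open>D\<close> and \<open>C\<close> are fixed before \<open>x\<close>.\<close>

lemma nn_integral_path_weight_step:
  assumes t: "t\<^sub>0 \<le> t" "t < T"
    and D: "\<And>x. (\<integral>\<^sup>+v. ennreal (pw (Suc t) x v) \<partial>PiM {Suc t..<T} \<mu>) = D * ennreal (quadratic_weight lam (\<Theta> (Suc t)) x)"
  obtains C :: "real^'m \<Rightarrow> ennreal" where
    "\<And>x l. (\<integral>\<^sup>+v. ennreal (exp (l \<bullet> (v t - lqr_gain A B M N T t *v x))) * ennreal (pw t x v) \<partial>PiM {t..<T} \<mu>)
        = C l * ennreal (quadratic_weight lam (\<Theta> t) x)"
    "\<And>l. C l \<le> ennreal (exp (l \<bullet> (S t *v l) / 2)) * C 0"
proof -
  obtain L :: "real^'m^'m" where L: "L ** transpose L = S t" "\<mu> t = distr std_normal_vec borel ((*v) L)"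
    using normal[OF t] by blast
  from gaussian_riccati_step[OF psd_\<Theta>[OF Suc_leI[OF t(2)]] N[OF t(2)] S[OF t(2)] lam NS[OF t(2)] L, where A="A t" and B="B t"]
  obtain C :: "real^'m \<Rightarrow> ennreal" where C:
    "\<And>x l. (\<integral>\<^sup>+v. ennreal (exp (l \<bullet> (v - lqr_gain A B M N T t *v x))
          * quadratic_weight lam (\<Theta> (Suc t)) (A t *v x + B t *v v)) \<partial>\<mu> t)
        = C l * ennreal (quadratic_weight lam (riccati_R (A t) (\<Theta> (Suc t)) (B t) (N t)) x)"
    "\<And>l. C l \<le> ennreal (exp (l \<bullet> (S t *v l) / 2)) * C 0"
    unfolding lqr_gain_eq_riccati_K by blast
  note sets_\<mu>[measurable_cong]
  have "(\<integral>\<^sup>+v. ennreal (exp (l \<bullet> (v t - lqr_gain A B M N T t *v x))) * ennreal (pw t x v) \<partial>PiM {t..<T} \<mu>)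
        = D * C l * ennreal (quadratic_weight lam (\<Theta> t) x)" for x l
  proof -
    have "(\<integral>\<^sup>+v. ennreal (exp (l \<bullet> (v t - lqr_gain A B M N T t *v x))) * ennreal (pw t x v) \<partial>PiM {t..<T} \<mu>)
      = ennreal (quadratic_weight lam (M t) x) * (\<integral>\<^sup>+y. ennreal (exp (l \<bullet> (y - lqr_gain A B M N T t *v x))) *
        (D * ennreal (quadratic_weight lam (\<Theta> (Suc t)) (A t *v x + B t *v y))) \<partial>\<mu> t)"
      by (subst nn_integral_path_weight_peel[OF prob sets_\<mu> t(2),
            where f="\<lambda>y. ennreal (exp (l \<bullet> (y - lqr_gain A B M N T t *v x)))"]) (simp_all add: D)
    also have "\<dots> = ennreal (quadratic_weight lam (M t) x) * (\<integral>\<^sup>+y. D * ennreal (exp (l \<bullet> (y - lqr_gain A B M N T t *v x)) *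
        quadratic_weight lam (\<Theta> (Suc t)) (A t *v x + B t *v y)) \<partial>\<mu> t)"
      by (simp add: ennreal_mult' ac_simps)
    also have "\<dots> = ennreal (quadratic_weight lam (M t) x) * (D *
        (C l * ennreal (quadratic_weight lam (riccati_R (A t) (\<Theta> (Suc t)) (B t) (N t)) x)))"
      by (subst nn_integral_cmult) (measurable, simp_all add: C)
    also have "\<dots> = D * C l * (ennreal (quadratic_weight lam (riccati_R (A t) (\<Theta> (Suc t)) (B t) (N t)) x)
        * ennreal (quadratic_weight lam (M t) x))"
      by (simp only: ac_simps)
    also have "\<dots> = D * C l * ennreal (quadratic_weight lam (\<Theta> t) x)"
      unfolding riccati_Suc[OF t(2)] quadratic_weight_add
      by (intro arg_cong2[where f="(*)"] refl ennreal_mult'[symmetric]) (simp add: quadratic_weight_def)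
    finally show ?thesis .
  qed
  moreover have "D * C l \<le> ennreal (exp (l \<bullet> (S t *v l) / 2)) * (D * C 0)" for l
    using mult_left_mono[OF C(2)[of l], of D] by (simp add: ac_simps)
  ultimately show thesis by (rule that)
qed

text \<open>The path integral form of the linear-quadratic value function. The constant collects the
  Gaussian normalisations of all later steps and cancels when \<open>C l\<close> is compared with
  \<open>C 0\<close>.\<close>

lemma nn_integral_path_weight:
  assumes "t\<^sub>0 \<le> t" "t \<le> T"
  shows "\<exists>C. \<forall>x. (\<integral>\<^sup>+v. ennreal (pw t x v) \<partial>PiM {t..<T} \<mu>) = C * ennreal (quadratic_weight lam (\<Theta> t) x)"
  using assms(2)
proof (induction rule: inc_induct)
  case base
  interpret product_prob_space \<mu> UNIV by (intro product_prob_spaceI prob)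
  \<comment> \<open>At the horizon only the terminal cost is left and no control remains to be
    integrated, so the constant is 1.\<close>
  have "pw T x v = quadratic_weight lam (\<Theta> T) x" for x v
    unfolding path_weight_def quadratic_weight_def by simp
  then show ?case by (intro exI[of _ 1]) (simp add: PiM_empty)
next
  case (step t)
  then obtain D where "\<And>x. (\<integral>\<^sup>+v. ennreal (pw (Suc t) x v) \<partial>PiM {Suc t..<T} \<mu>)
      = D * ennreal (quadratic_weight lam (\<Theta> (Suc t)) x)" by blast
  note D = this
  obtain C :: "real^'m \<Rightarrow> ennreal" where
    "\<And>x l. (\<integral>\<^sup>+v. ennreal (exp (l \<bullet> (v t - lqr_gain A B M N T t *v x))) * ennreal (pw t x v) \<partial>PiM {t..<T} \<mu>)
        = C l * ennreal (quadratic_weight lam (\<Theta> t) x)"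
    by (rule nn_integral_path_weight_step[OF order_trans[OF assms(1) step(1)] step(2) D]) (rule that)
  from this[of 0] show ?case by (intro exI[of _ "C 0"]) simp
qed

text \<open>The weight here multiplies the deviation inside the exponential, whereas the Gaussian
  computation has it outside. Convexity of \<open>exp\<close> passes from one to the other.\<close>

lemma weighted_control_subgaussian:
  assumes t: "t\<^sub>0 \<le> t" "t < T"
  shows "(\<integral>\<^sup>+v. ennreal (exp (pw t x v * (l \<bullet> (v t - lqr_gain A B M N T t *v x)))) \<partial>PiM {t..<T} \<mu>)
    \<le> ennreal (exp (l \<bullet> (S t *v l) / 2))" (is "?I \<le> ennreal ?c")
proof -
  interpret W: prob_space "PiM {t..<T} \<mu>" by (rule prob_space_PiM) (rule prob)
  note sets_\<mu>[measurable_cong]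
  note meas = borel_measurable_PiM_component[of \<mu>, OF sets_\<mu>]
  have [measurable]: "(\<lambda>v. pw t x v) \<in> borel_measurable (PiM {t..<T} \<mu>)"
    by (intro borel_measurable_path_weight meas) simp_all
  have [measurable]: "(\<lambda>v. v t) \<in> PiM {t..<T} \<mu> \<rightarrow>\<^sub>M borel"
    using t by (intro meas) simp
  obtain D where "\<And>x. (\<integral>\<^sup>+v. ennreal (pw (Suc t) x v) \<partial>PiM {Suc t..<T} \<mu>)
      = D * ennreal (quadratic_weight lam (\<Theta> (Suc t)) x)"
    using nn_integral_path_weight[OF le_SucI[OF t(1)] Suc_leI[OF t(2)]] by blast
  note D = this
  obtain C :: "real^'m \<Rightarrow> ennreal" where C:
    "\<And>x l. (\<integral>\<^sup>+v. ennreal (exp (l \<bullet> (v t - lqr_gain A B M N T t *v x))) * ennreal (pw t x v) \<partial>PiM {t..<T} \<mu>)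
        = C l * ennreal (quadratic_weight lam (\<Theta> t) x)"
    "\<And>l. C l \<le> ennreal (exp (l \<bullet> (S t *v l) / 2)) * C 0"
    by (rule nn_integral_path_weight_step[OF t D]) (rule that)
  define y where "y v = l \<bullet> (v t - lqr_gain A B M N T t *v x)" for v :: "nat \<Rightarrow> real^'m"
  have [measurable]: "y \<in> borel_measurable (PiM {t..<T} \<mu>)" unfolding y_def by measurable
  define I1 where "I1 = (\<integral>\<^sup>+v. ennreal (pw t x v) \<partial>PiM {t..<T} \<mu>)"
  define I2 where "I2 = (\<integral>\<^sup>+v. ennreal (exp (y v)) * ennreal (pw t x v) \<partial>PiM {t..<T} \<mu>)"
  have "I2 \<le> ennreal ?c * I1"
    using mult_right_mono[OF C(2)[of l], of "ennreal (quadratic_weight lam (\<Theta> t) x)"] C(1)[of 0 x] C(1)[of l x]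
    by (simp add: I1_def I2_def y_def mult.assoc)
  have nonneg: "0 \<le> pw t x v" for v
    using path_weight_pos by (rule less_imp_le)
  have le1: "pw t x v \<le> 1" for v
    using M lam by (rule path_weight_le_1)
  \<comment> \<open>The mean weight must be finite, since it is added to both sides below and
    cancelled at the end; that it is at most 1 is used once more in the last estimate.\<close>
  have "I1 \<le> (\<integral>\<^sup>+v. 1 \<partial>PiM {t..<T} \<mu>)"
    unfolding I1_def by (intro nn_integral_mono) (simp add: le1)
  then have "I1 \<le> 1" by (simp add: W.emeasure_space_1)
  moreover from this have "I1 \<noteq> \<top>" by (auto simp: top_unique)
  ultimately obtain d where d: "I1 = ennreal d" "0 \<le> d" "d \<le> 1"
    by (cases I1) auto
  \<comment> \<open>The chord of \<open>exp\<close> between \<open>0\<close> and \<open>y\<close>,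
    evaluated at \<open>p * y\<close>.\<close>
  have convex: "exp (p * y) + p \<le> 1 + exp y * p" if "0 \<le> p" "p \<le> 1" for p y :: real
  proof -
    have "exp (p * y) \<le> (1 - p) * exp 0 + p * exp y"
      using convex_onD[OF exp_convex, of p 0 y] that by simp
    then show ?thesis by (simp add: algebra_simps)
  qed
  have "?I + I1 = (\<integral>\<^sup>+v. ennreal (exp (pw t x v * y v) + pw t x v) \<partial>PiM {t..<T} \<mu>)"
    unfolding I1_def y_def[symmetric]
    by (subst nn_integral_add[symmetric])
       (simp_all add: nonneg)
  also have "\<dots> \<le> (\<integral>\<^sup>+v. 1 + ennreal (exp (y v)) * ennreal (pw t x v) \<partial>PiM {t..<T} \<mu>)"
  proof (rule nn_integral_mono)
    fix v
    have "ennreal (exp (pw t x v * y v) + pw t x v) \<le> ennreal (1 + exp (y v) * pw t x v)"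
      using nonneg le1 by (intro ennreal_leI convex)
    also have "\<dots> = 1 + ennreal (exp (y v)) * ennreal (pw t x v)"
      by (simp add: nonneg ennreal_mult')
    finally show "ennreal (exp (pw t x v * y v) + pw t x v) \<le> \<dots>" .
  qed
  also have "\<dots> = 1 + I2"
    unfolding I2_def by (subst nn_integral_add) (simp_all add: W.emeasure_space_1)
  also have "\<dots> \<le> 1 + ennreal ?c * I1"
    using \<open>I2 \<le> _\<close> by (rule add_left_mono)
  also have "\<dots> = ennreal (1 + ?c * d)"
    using d by (simp add: ennreal_mult')
  also have "\<dots> \<le> ennreal (?c + d)"
  proof (rule ennreal_leI)
    \<comment> \<open>The estimate is \<open>(?c - 1) * (1 - d) \<ge> 0\<close> multiplied out; this
      is where the factor \<open>?c\<close> is kept without loss.\<close>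
    have "1 \<le> ?c"
      using pos_definite_imp_semidefinite[OF S[OF t(2)]] by (simp add: pos_semidefinite_def)
    then have "0 \<le> (?c - 1) * (1 - d)" using d by simp
    then show "1 + ?c * d \<le> ?c + d" by (simp add: algebra_simps)
  qed
  also have "\<dots> = ennreal ?c + I1" using d by simp
  finally show ?thesis
    using d by (simp add: ennreal_add_left_cancel_le add.commute)
qed

end

subsection \<open>Concentration of the sampled controls\<close>

text \<open>Independence is assumed over values of \<open>source\<close>, while the sums run over
  pairs and over times; the injections between these index sets carry it across.\<close>

lemma (in prob_space) indep_sets_reindex:
  assumes inj: "inj_on f I" and indep: "indep_sets F (f ` I)"
  shows "indep_sets (\<lambda>i. F (f i)) I"
proof (rule indep_setsI)
  show "F (f i) \<subseteq> events" if "i \<in> I" for i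
    using indep that by (auto simp: indep_sets_def)
next
  fix A J assume J: "J \<noteq> {}" "J \<subseteq> I" "finite J" "\<forall>j\<in>J. A j \<in> F (f j)"
  have inj': "inj_on f J" using inj J(2) by (rule inj_on_subset)
  let ?A = "\<lambda>k. A (the_inv_into J f k)"
  have A: "?A (f j) = A j" if "j \<in> J" for j
    using that inj' by (simp add: the_inv_into_f_f)
  have "prob (\<Inter>k\<in>f ` J. ?A k) = (\<Prod>k\<in>f ` J. prob (?A k))"
    using J A by (intro indep_setsD[OF indep]) auto
  then show "prob (\<Inter>j\<in>J. A j) = (\<Prod>j\<in>J. prob (A j))"
    using A by (simp add: prod.reindex[OF inj'])
qed

lemma (in prob_space) indep_vars_reindex:
  assumes "inj_on f I" "indep_vars M' X (f ` I)"
  shows "indep_vars (\<lambda>i. M' (f i)) (\<lambda>i. X (f i)) I"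
  using assms indep_sets_reindex[OF assms(1), of "\<lambda>i. {X i -` A \<inter> space M |A. A \<in> sets (M' i)}"]
  unfolding indep_vars_def2 by auto

text \<open>The counterpart of \<open>generated_events\<close> for an arbitrary target space, since
  a whole array of samples takes values in a \<open>PiM\<close> space.\<close>

definition (in prob_space) generated_sets :: "'b measure \<Rightarrow> ('a \<Rightarrow> 'b) \<Rightarrow> 'a set set" where
  "generated_sets S X = {X -` A \<inter> space M |A. A \<in> sets S}"

text \<open>Unlike \<open>indep_var_distribution_eq\<close>, this allows \<open>X\<close> and \<open>Y\<close> to have different types.\<close>

lemma (in prob_space) indep_set_distr_Pair:
  assumes [measurable]: "X \<in> M \<rightarrow>\<^sub>M S" "Y \<in> M \<rightarrow>\<^sub>M R"
    and indep: "indep_set (generated_sets S X) (generated_sets R Y)"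
  shows "distr M S X \<Otimes>\<^sub>M distr M R Y = distr M (S \<Otimes>\<^sub>M R) (\<lambda>x. (X x, Y x))"
proof (rule pair_measure_eqI)
  fix A B assume "A \<in> sets (distr M S X)" "B \<in> sets (distr M R Y)"
  then have [measurable]: "A \<in> sets S" "B \<in> sets R" by simp_all
  have "prob ((X -` A \<inter> space M) \<inter> (Y -` B \<inter> space M)) = prob (X -` A \<inter> space M) * prob (Y -` B \<inter> space M)"
    by (rule indep_setD[OF indep]) (auto simp: generated_sets_def)
  moreover have "(\<lambda>x. (X x, Y x)) -` (A \<times> B) \<inter> space M = (X -` A \<inter> space M) \<inter> (Y -` B \<inter> space M)"
    by auto
  ultimately show "emeasure (distr M S X) A * emeasure (distr M R Y) B
      = emeasure (distr M (S \<Otimes>\<^sub>M R) (\<lambda>x. (X x, Y x))) (A \<times> B)"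
    by (simp add: emeasure_distr emeasure_eq_measure ennreal_mult)
qed (auto intro!: prob_space_imp_sigma_finite prob_space_distr)

text \<open>Freezes the first argument: a bound on the inner integral for every fixed value extends
  to a random value independent of the second argument.\<close>

lemma (in prob_space) indep_set_nn_integral:
  assumes [measurable]: "X \<in> M \<rightarrow>\<^sub>M S" "Y \<in> M \<rightarrow>\<^sub>M R"
    and indep: "indep_set (generated_sets S X) (generated_sets R Y)"
    and [measurable]: "f \<in> borel_measurable (S \<Otimes>\<^sub>M R)"
  shows "(\<integral>\<^sup>+\<omega>. f (X \<omega>, Y \<omega>) \<partial>M) = (\<integral>\<^sup>+\<omega>. (\<integral>\<^sup>+\<omega>'. f (X \<omega>, Y \<omega>') \<partial>M) \<partial>M)"
proof -
  interpret Y: prob_space "distr M R Y" by (rule prob_space_distr) simp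
  have "(\<integral>\<^sup>+\<omega>. f (X \<omega>, Y \<omega>) \<partial>M) = (\<integral>\<^sup>+z. f z \<partial>(distr M S X \<Otimes>\<^sub>M distr M R Y))"
    unfolding indep_set_distr_Pair[OF assms(1-3)] by (simp add: nn_integral_distr)
  also have "\<dots> = (\<integral>\<^sup>+x. (\<integral>\<^sup>+y. f (x, y) \<partial>distr M R Y) \<partial>distr M S X)"
    by (rule Y.nn_integral_fst[symmetric]) simp
  also have "\<dots> = (\<integral>\<^sup>+\<omega>. (\<integral>\<^sup>+y. f (X \<omega>, y) \<partial>distr M R Y) \<partial>M)"
    by (rule nn_integral_distr) measurable
  also have "\<dots> = (\<integral>\<^sup>+\<omega>. (\<integral>\<^sup>+\<omega>'. f (X \<omega>, Y \<omega>') \<partial>M) \<partial>M)"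
  proof (rule nn_integral_cong)
    fix \<omega> assume "\<omega> \<in> space M"
    then have [measurable]: "X \<omega> \<in> space S" by (rule measurable_space[rotated]) simp
    show "(\<integral>\<^sup>+y. f (X \<omega>, y) \<partial>distr M R Y) = (\<integral>\<^sup>+\<omega>'. f (X \<omega>, Y \<omega>') \<partial>M)"
      by (rule nn_integral_distr) measurable
  qed
  finally show ?thesis .
qed

lemma (in prob_space) subgaussian_tail:
  assumes [measurable]: "X \<in> borel_measurable M" and v: "0 < v" and a: "0 < a"
    and mgf: "\<And>s. 0 < s \<Longrightarrow> (\<integral>\<^sup>+\<omega>. ennreal (exp (s * X \<omega>)) \<partial>M) \<le> ennreal (exp (s\<^sup>2 * v / 2))"
  shows "prob {\<omega> \<in> space M. X \<omega> \<ge> a} \<le> exp (- a\<^sup>2 / (2 * v))"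
proof -
  \<comment> \<open>The minimiser of the Chernoff exponent
    \<open>- s * a + s^2 * v / 2\<close>.\<close>
  define s where "s = a / v"
  have s: "0 < s" using a v by (simp add: s_def)
  have "emeasure M {\<omega> \<in> space M. X \<omega> \<ge> a}
      \<le> ennreal (exp (- s * a)) * (\<integral>\<^sup>+\<omega>. ennreal (exp (s * X \<omega>)) * indicator (space M) \<omega> \<partial>M)"
    by (rule Chernoff_ineq_nn_integral_ge[OF s]) simp_all
  also have "(\<integral>\<^sup>+\<omega>. ennreal (exp (s * X \<omega>)) * indicator (space M) \<omega> \<partial>M) = (\<integral>\<^sup>+\<omega>. ennreal (exp (s * X \<omega>)) \<partial>M)"
    by (rule nn_integral_cong) simp
  also have "ennreal (exp (- s * a)) * \<dots> \<le> ennreal (exp (- s * a)) * ennreal (exp (s\<^sup>2 * v / 2))"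
    by (intro mult_left_mono mgf s) simp
  also have "\<dots> = ennreal (exp (- s * a + s\<^sup>2 * v / 2))"
    unfolding exp_add by (rule ennreal_mult'[symmetric]) simp
  also have "- s * a + s\<^sup>2 * v / 2 = - a\<^sup>2 / (2 * v)"
    using v by (simp add: s_def power2_eq_square field_simps)
  finally show ?thesis by (simp add: emeasure_eq_measure)
qed

lemma inner_matrix_vector_le_onorm:
  fixes S :: "real^'n^'n"
  shows "l \<bullet> (S *v l) \<le> onorm ((*v) S) * (norm l)\<^sup>2"
proof -
  have "l \<bullet> (S *v l) \<le> norm l * norm (S *v l)" by (rule norm_cauchy_schwarz)
  also have "\<dots> \<le> norm l * (onorm ((*v) S) * norm l)"
    by (intro mult_left_mono onorm matrix_vector_mul_bounded_linear) simp
  finally show ?thesis by (simp add: power2_eq_square ac_simps)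
qed

lemma onorm_pos_definite_pos:
  fixes S :: "real^'n^'n"
  assumes "pos_definite S"
  shows "0 < onorm ((*v) S)"
proof -
  let ?l = "axis undefined 1 :: real^'n"
  have "0 < ?l \<bullet> (S *v ?l)" using assms by (simp add: pos_definite_def axis_eq_0_iff)
  also have "\<dots> \<le> onorm ((*v) S)" using inner_matrix_vector_le_onorm[of ?l S] by (simp add: norm_axis_1)
  finally show ?thesis .
qed

section \<open>Chernoff bound for the weighted deviations at one time step\<close>

context
  fixes P :: "'w measure" and A M :: "nat \<Rightarrow> real^'n^'n" and B :: "nat \<Rightarrow> real^'m^'n"
    and N S :: "nat \<Rightarrow> real^'m^'m" and lam :: real and t T :: nat
  assumes P: "prob_space P"
    and M: "\<And>t. t \<le> T \<Longrightarrow> pos_definite (M t)" and N: "\<And>t. t < T \<Longrightarrow> pos_definite (N t)"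
    and lam: "0 < lam" and S: "\<And>t. t < T \<Longrightarrow> pos_definite (S t)"
    and NS: "\<And>t. t < T \<Longrightarrow> N t = lam *\<^sub>R matrix_inv (S t)"
    and t: "t < T"
begin

abbreviation (input) "dev x v \<equiv>
  path_weight A B M lam T t x v *\<^sub>R (v t - lqr_gain A B M N T t *v x)"

lemma sample_subgaussian:
  assumes normal: "\<And>k. t \<le> k \<Longrightarrow> k < T \<Longrightarrow> centered_normal P (V k) (S k)"
    and indep: "prob_space.indep_vars P (\<lambda>_. borel) V {t..<T}"
  shows "(\<integral>\<^sup>+\<omega>. ennreal (exp (l \<bullet> dev x (\<lambda>k. V k \<omega>))) \<partial>P) \<le> ennreal (exp (l \<bullet> (S t *v l) / 2))"
proof -
  interpret prob_space P by (rule P)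
  \<comment> \<open>Nothing is known about \<open>V k\<close> outside the range of sampled times.
    The constant 0 there makes every \<open>\<mu> k\<close> a probability measure, as the locale
    demands, and leaves the path weight unchanged.\<close>
  define V' where "V' k = (if k \<in> {t..<T} then V k else (\<lambda>_. 0))" for k
  have [measurable]: "V' k \<in> borel_measurable P" for k
    using normal unfolding V'_def centered_normal_def by auto
  define \<mu> where "\<mu> k = distr P borel (V' k)" for k
  have sets_\<mu>: "sets (\<mu> k) = sets borel" for k by (simp add: \<mu>_def)
  have prob_\<mu>: "prob_space (\<mu> k)" for k unfolding \<mu>_def by (intro prob_space_distr) simp
  note sets_\<mu>[measurable_cong]
  interpret path_integral_model A M B N S lam t T \<mu>
  proof (rule path_integral_model.intro)
    show "\<exists>L :: real^'m^'m. L ** transpose L = S k \<and> \<mu> k = distr std_normal_vec borel ((*v) L)"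
      if "t \<le> k" "k < T" for k
      using normal[OF that] that by (auto simp: centered_normal_def \<mu>_def V'_def)
  qed (erule M N S NS | rule lam sets_\<mu> prob_\<mu>)+
  have "indep_vars (\<lambda>_. borel) V' {t..<T}"
    using indep by (subst indep_vars_cong[where Y=V]) (auto simp: V'_def)
  then have distr: "distr P (PiM {t..<T} (\<lambda>_. borel)) (\<lambda>\<omega>. \<lambda>k\<in>{t..<T}. V' k \<omega>) = PiM {t..<T} \<mu>"
    unfolding \<mu>_def using t by (subst (asm) indep_vars_iff_distr_eq_PiM) auto
  have [measurable]: "(\<lambda>v. v t) \<in> PiM {t..<T} (\<lambda>_. borel) \<rightarrow>\<^sub>M borel"
    using t by (intro measurable_component_singleton) simp
  have [measurable]: "(\<lambda>v. path_weight A B M lam T t x v) \<in> borel_measurable (PiM {t..<T} (\<lambda>_. borel))"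
    by (intro borel_measurable_path_weight measurable_component_singleton) simp_all
  have "(\<integral>\<^sup>+\<omega>. ennreal (exp (l \<bullet> dev x (\<lambda>k. V k \<omega>))) \<partial>P)
      = (\<integral>\<^sup>+\<omega>. ennreal (exp (l \<bullet> dev x (\<lambda>k\<in>{t..<T}. V' k \<omega>))) \<partial>P)"
  proof (rule nn_integral_cong)
    fix \<omega>
    have "path_weight A B M lam T t x (\<lambda>k. V k \<omega>) = path_weight A B M lam T t x (\<lambda>k\<in>{t..<T}. V' k \<omega>)"
      by (rule path_weight_cong) (simp add: V'_def)
    then show "ennreal (exp (l \<bullet> dev x (\<lambda>k. V k \<omega>))) = ennreal (exp (l \<bullet> dev x (\<lambda>k\<in>{t..<T}. V' k \<omega>)))"
      using t by (simp add: V'_def)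
  qed
  also have "\<dots> = (\<integral>\<^sup>+v. ennreal (exp (l \<bullet> dev x v)) \<partial>PiM {t..<T} \<mu>)"
    unfolding distr[symmetric] by (subst nn_integral_distr) measurable
  also have "\<dots> \<le> ennreal (exp (l \<bullet> (S t *v l) / 2))"
    using weighted_control_subgaussian[OF order_refl t, of x l] by simp
  finally show ?thesis .
qed

lemma borel_measurable_path_weight_row:
  assumes "g \<in> borel_measurable F" and h: "h \<in> F \<rightarrow>\<^sub>M PiM K (\<lambda>_. borel)" and K: "{i} \<times> {t..<T} \<subseteq> K"
  shows "(\<lambda>z. path_weight A B M lam T t (g z) (\<lambda>k. h z (i, k))) \<in> borel_measurable F"
proof (rule borel_measurable_path_weight)
  fix k assume "t \<le> k" "k < T"
  then have "(i, k) \<in> K" using K by auto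
  then show "(\<lambda>z. h z (i, k)) \<in> borel_measurable F"
    by (intro measurable_compose[OF h measurable_component_singleton])
qed fact

text \<open>For a frozen state the trajectories are independent, so the moment generating functions
  multiply to the \<open>n\<close>-th power of a bound free of the state. Integrating over the
  random state then costs nothing.\<close>

lemma sample_sum_subgaussian:
  fixes X :: "'w \<Rightarrow> real^'n" and V :: "nat \<Rightarrow> nat \<Rightarrow> 'w \<Rightarrow> real^'m" and n :: nat
  defines "J \<equiv> {..<n} \<times> {t..<T}"
  assumes normal: "\<And>i k. i < n \<Longrightarrow> t \<le> k \<Longrightarrow> k < T \<Longrightarrow> centered_normal P (V i k) (S k)"
    and indepV: "prob_space.indep_vars P (\<lambda>_. borel) (\<lambda>p. V (fst p) (snd p)) J"
    and X: "X \<in> borel_measurable P"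
    and indepX: "prob_space.indep_set P (prob_space.generated_sets P borel X)
      (prob_space.generated_sets P (PiM J (\<lambda>_. borel)) (\<lambda>\<omega>. \<lambda>p\<in>J. V (fst p) (snd p) \<omega>))"
  shows "(\<integral>\<^sup>+\<omega>. ennreal (exp (l \<bullet> (\<Sum>i<n. dev (X \<omega>) (\<lambda>k. V i k \<omega>)))) \<partial>P)
    \<le> ennreal (exp (real n * (l \<bullet> (S t *v l)) / 2))"
proof -
  interpret prob_space P by (rule P)
  note meas = borel_measurable_path_weight_row
  have VV: "(\<lambda>\<omega>. \<lambda>p\<in>J. V (fst p) (snd p) \<omega>) \<in> P \<rightarrow>\<^sub>M PiM J (\<lambda>_. borel)"
    using normal by (intro measurable_restrict) (auto simp: J_def centered_normal_def)
  \<comment> \<open>Written as a function of the state and the whole sample array, so that it is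
    jointly measurable and the state can be frozen.\<close>
  define G where "G x v = (\<Prod>i<n. ennreal (exp (l \<bullet> dev x (\<lambda>k. v (i, k)))))" for x and v :: "nat \<times> nat \<Rightarrow> real^'m"
  have G_meas: "(\<lambda>z. G (fst z) (snd z)) \<in> borel_measurable (borel \<Otimes>\<^sub>M PiM J (\<lambda>_. borel))"
    unfolding G_def
  proof (rule borel_measurable_prod_ennreal)
    fix i assume i: "i \<in> {..<n}"
    have [measurable]: "(\<lambda>z. path_weight A B M lam T t (fst z) (\<lambda>k. snd z (i, k)))
        \<in> borel_measurable (borel \<Otimes>\<^sub>M PiM J (\<lambda>_. borel))"
      using i by (intro meas[OF measurable_fst measurable_snd]) (auto simp: J_def)
    have [measurable]: "(\<lambda>z. snd z (i, t)) \<in> borel_measurable (borel \<Otimes>\<^sub>M PiM J (\<lambda>_. borel))"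
      using i t by (intro measurable_compose[OF measurable_snd measurable_component_singleton]) (simp add: J_def)
    show "(\<lambda>z. ennreal (exp (l \<bullet> dev (fst z) (\<lambda>k. snd z (i, k))))) \<in> borel_measurable (borel \<Otimes>\<^sub>M PiM J (\<lambda>_. borel))"
      by measurable
  qed
  have G_eq: "G x (\<lambda>p\<in>J. V (fst p) (snd p) \<omega>) = (\<Prod>i<n. ennreal (exp (l \<bullet> dev x (\<lambda>k. V i k \<omega>))))" for x \<omega>
    unfolding G_def
  proof (rule prod.cong[OF refl])
    fix i assume i: "i \<in> {..<n}"
    have "path_weight A B M lam T t x (\<lambda>k. (\<lambda>p\<in>J. V (fst p) (snd p) \<omega>) (i, k))
        = path_weight A B M lam T t x (\<lambda>k. V i k \<omega>)"
      using i by (intro path_weight_cong) (simp add: J_def)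
    then show "ennreal (exp (l \<bullet> dev x (\<lambda>k. (\<lambda>p\<in>J. V (fst p) (snd p) \<omega>) (i, k))))
        = ennreal (exp (l \<bullet> dev x (\<lambda>k. V i k \<omega>)))"
      using i t by (simp add: J_def)
  qed
  have bound: "(\<integral>\<^sup>+\<omega>'. (\<Prod>i<n. ennreal (exp (l \<bullet> dev x (\<lambda>k. V i k \<omega>')))) \<partial>P)
      \<le> ennreal (exp (real n * (l \<bullet> (S t *v l)) / 2))" for x
  proof -
    \<comment> \<open>The rows are disjoint blocks of one independent array, hence the trajectories
      are independent of each other.\<close>
    have "indep_vars (\<lambda>i. PiM ({i} \<times> {t..<T}) (\<lambda>_. borel))
        (\<lambda>i \<omega>. \<lambda>p\<in>{i} \<times> {t..<T}. V (fst p) (snd p) \<omega>) {..<n}"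
      by (rule indep_vars_restrict[OF indepV]) (auto simp: J_def disjoint_family_on_def)
    moreover have "(\<lambda>v. ennreal (exp (l \<bullet> dev x (\<lambda>k. v (i, k)))))
        \<in> PiM ({i} \<times> {t..<T}) (\<lambda>_. borel) \<rightarrow>\<^sub>M borel" for i
    proof -
      have [measurable]: "(\<lambda>v. v (i, t)) \<in> PiM ({i} \<times> {t..<T}) (\<lambda>_. borel) \<rightarrow>\<^sub>M borel"
        using t by (intro measurable_component_singleton) simp
      have [measurable]: "(\<lambda>v. path_weight A B M lam T t x (\<lambda>k. v (i, k)))
          \<in> borel_measurable (PiM ({i} \<times> {t..<T}) (\<lambda>_. borel))"
        by (rule meas[OF _ measurable_ident_sets[OF refl]]) simp_all
      show ?thesis by measurable
    qed
    ultimately have "indep_vars (\<lambda>_. borel)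
        (\<lambda>i \<omega>. ennreal (exp (l \<bullet> dev x (\<lambda>k. (\<lambda>p\<in>{i} \<times> {t..<T}. V (fst p) (snd p) \<omega>) (i, k))))) {..<n}"
      by (rule indep_vars_compose2)
    moreover have "ennreal (exp (l \<bullet> dev x (\<lambda>k. (\<lambda>p\<in>{i} \<times> {t..<T}. V (fst p) (snd p) \<omega>) (i, k))))
        = ennreal (exp (l \<bullet> dev x (\<lambda>k. V i k \<omega>)))" for i \<omega>
    proof -
      have "path_weight A B M lam T t x (\<lambda>k. (\<lambda>p\<in>{i} \<times> {t..<T}. V (fst p) (snd p) \<omega>) (i, k))
          = path_weight A B M lam T t x (\<lambda>k. V i k \<omega>)"
        by (intro path_weight_cong) simp
      then show ?thesis using t by simp
    qed
    ultimately have "indep_vars (\<lambda>_. borel) (\<lambda>i \<omega>. ennreal (exp (l \<bullet> dev x (\<lambda>k. V i k \<omega>)))) {..<n}"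
      by simp
    then have "(\<integral>\<^sup>+\<omega>'. (\<Prod>i<n. ennreal (exp (l \<bullet> dev x (\<lambda>k. V i k \<omega>')))) \<partial>P)
        = (\<Prod>i<n. \<integral>\<^sup>+\<omega>'. ennreal (exp (l \<bullet> dev x (\<lambda>k. V i k \<omega>'))) \<partial>P)"
      by (intro indep_vars_nn_integral) auto
    also have "\<dots> \<le> (\<Prod>i<n. ennreal (exp (l \<bullet> (S t *v l) / 2)))"
    proof (rule prod_mono_ennreal)
      fix i assume i: "i \<in> {..<n}"
      have "indep_vars (\<lambda>_. borel) (\<lambda>p. V (fst p) (snd p)) (Pair i ` {t..<T})"
        using indepV i by (rule_tac indep_vars_subset) (auto simp: J_def)
      then have "indep_vars (\<lambda>_. borel) (V i) {t..<T}"
        using indep_vars_reindex[of "Pair i" "{t..<T}"] by (force simp: inj_on_def)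
      then show "(\<integral>\<^sup>+\<omega>'. ennreal (exp (l \<bullet> dev x (\<lambda>k. V i k \<omega>'))) \<partial>P) \<le> ennreal (exp (l \<bullet> (S t *v l) / 2))"
        using normal i by (intro sample_subgaussian) auto
    qed
    also have "\<dots> = ennreal (exp (real n * (l \<bullet> (S t *v l)) / 2))"
      by (simp add: ennreal_power exp_of_nat_mult[symmetric])
    finally show ?thesis .
  qed
  have "(\<integral>\<^sup>+\<omega>. ennreal (exp (l \<bullet> (\<Sum>i<n. dev (X \<omega>) (\<lambda>k. V i k \<omega>)))) \<partial>P)
      = (\<integral>\<^sup>+\<omega>. G (X \<omega>) (\<lambda>p\<in>J. V (fst p) (snd p) \<omega>) \<partial>P)"
    unfolding G_eq by (simp add: inner_sum_right exp_sum prod_ennreal)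
  also have "\<dots> = (\<integral>\<^sup>+\<omega>. (\<integral>\<^sup>+\<omega>'. G (X \<omega>) (\<lambda>p\<in>J. V (fst p) (snd p) \<omega>') \<partial>P) \<partial>P)"
    using indep_set_nn_integral[OF X VV indepX G_meas] by simp
  also have "\<dots> \<le> (\<integral>\<^sup>+\<omega>. ennreal (exp (real n * (l \<bullet> (S t *v l)) / 2)) \<partial>P)"
    unfolding G_eq by (intro nn_integral_mono bound)
  finally show ?thesis by (simp add: emeasure_space_1)
qed

text \<open>The factor \<open>2 * CARD('m)\<close> comes from a union bound over the coordinates and
  their signs. For a unit vector, the variance proxy of the sum is at most \<open>n\<close> times
  the operator norm.\<close>

lemma sample_sum_tail:
  fixes X :: "'w \<Rightarrow> real^'n" and V :: "nat \<Rightarrow> nat \<Rightarrow> 'w \<Rightarrow> real^'m" and n :: nat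
  defines "J \<equiv> {..<n} \<times> {t..<T}"
  assumes n: "0 < n" and a: "0 < a"
    and normal: "\<And>i k. i < n \<Longrightarrow> t \<le> k \<Longrightarrow> k < T \<Longrightarrow> centered_normal P (V i k) (S k)"
    and indepV: "prob_space.indep_vars P (\<lambda>_. borel) (\<lambda>p. V (fst p) (snd p)) J"
    and X[measurable]: "X \<in> borel_measurable P"
    and indepX: "prob_space.indep_set P (prob_space.generated_sets P borel X)
      (prob_space.generated_sets P (PiM J (\<lambda>_. borel)) (\<lambda>\<omega>. \<lambda>p\<in>J. V (fst p) (snd p) \<omega>))"
  defines "Z \<equiv> (\<lambda>\<omega>. \<Sum>i<n. dev (X \<omega>) (\<lambda>k. V i k \<omega>))"
  shows "Z \<in> borel_measurable P"
    and "measure P {\<omega> \<in> space P. a \<le> infnorm (Z \<omega>)}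
      \<le> 2 * real CARD('m) * exp (- a\<^sup>2 / (2 * (real n * onorm ((*v) (S t)))))"
proof -
  interpret prob_space P by (rule P)
  have [measurable]: "V i k \<in> borel_measurable P" if "i < n" "t \<le> k" "k < T" for i k
    using normal[OF that] by (simp add: centered_normal_def)
  have [measurable]: "(\<lambda>\<omega>. path_weight A B M lam T t (X \<omega>) (\<lambda>k. V i k \<omega>)) \<in> borel_measurable P" if "i \<in> {..<n}" for i
    using that by (intro borel_measurable_path_weight) auto
  have [measurable]: "V i t \<in> borel_measurable P" if "i \<in> {..<n}" for i
    using that t by simp
  show Z: "Z \<in> borel_measurable P" unfolding Z_def by measurable
  note Z[measurable]
  have ev: "{\<omega> \<in> space P. a \<le> e \<bullet> Z \<omega>} \<in> sets P" for e by measurable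
  let ?b = "exp (- a\<^sup>2 / (2 * (real n * onorm ((*v) (S t)))))"
  have tail: "prob {\<omega> \<in> space P. a \<le> e \<bullet> Z \<omega>} \<le> ?b" if e: "norm e = 1" for e
  proof (rule subgaussian_tail)
    fix s :: real assume "0 < s"
    have "(\<integral>\<^sup>+\<omega>. ennreal (exp (s * (e \<bullet> Z \<omega>))) \<partial>P) = (\<integral>\<^sup>+\<omega>. ennreal (exp ((s *\<^sub>R e) \<bullet> Z \<omega>)) \<partial>P)"
      by simp
    also have "\<dots> \<le> ennreal (exp (real n * ((s *\<^sub>R e) \<bullet> (S t *v (s *\<^sub>R e))) / 2))"
      unfolding Z_def by (rule sample_sum_subgaussian[OF normal indepV[unfolded J_def] X indepX[unfolded J_def]])
    also have "\<dots> \<le> ennreal (exp (s\<^sup>2 * (real n * onorm ((*v) (S t))) / 2))"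
    proof (intro ennreal_leI, simp only: exp_le_cancel_iff)
      have "(s *\<^sub>R e) \<bullet> (S t *v (s *\<^sub>R e)) \<le> onorm ((*v) (S t)) * s\<^sup>2"
        using inner_matrix_vector_le_onorm[of "s *\<^sub>R e" "S t"] e by (simp add: power2_eq_square)
      from mult_left_mono[OF this, of "real n"]
      show "real n * ((s *\<^sub>R e) \<bullet> (S t *v (s *\<^sub>R e))) / 2 \<le> s\<^sup>2 * (real n * onorm ((*v) (S t))) / 2"
        by (simp add: ac_simps)
    qed
    finally show "(\<integral>\<^sup>+\<omega>. ennreal (exp (s * (e \<bullet> Z \<omega>))) \<partial>P)
      \<le> ennreal (exp (s\<^sup>2 * (real n * onorm ((*v) (S t))) / 2))" .
  qed (use a n onorm_pos_definite_pos[OF S[OF t]] in simp_all)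
  \<comment> \<open>The maximum norm is attained at some basis vector, and its absolute value is one
    of two signed coordinates.\<close>
  have "{\<omega> \<in> space P. a \<le> infnorm (Z \<omega>)}
    \<subseteq> (\<Union>e\<in>Basis. {\<omega> \<in> space P. a \<le> e \<bullet> Z \<omega>} \<union> {\<omega> \<in> space P. a \<le> (- e) \<bullet> Z \<omega>})"
  proof
    fix \<omega> assume \<omega>: "\<omega> \<in> {\<omega> \<in> space P. a \<le> infnorm (Z \<omega>)}"
    have "infnorm (Z \<omega>) \<in> (\<lambda>e. \<bar>Z \<omega> \<bullet> e\<bar>) ` Basis"
      unfolding infnorm_Max by (intro Max_in) auto
    then obtain e where e: "e \<in> Basis" "infnorm (Z \<omega>) = \<bar>Z \<omega> \<bullet> e\<bar>" by auto
    with \<omega> have "a \<le> e \<bullet> Z \<omega> \<or> a \<le> (- e) \<bullet> Z \<omega>" by (auto simp: abs_if inner_commute split: if_splits)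
    with \<omega> e show "\<omega> \<in> (\<Union>e\<in>Basis. {\<omega> \<in> space P. a \<le> e \<bullet> Z \<omega>} \<union> {\<omega> \<in> space P. a \<le> (- e) \<bullet> Z \<omega>})"
      by blast
  qed
  then have "prob {\<omega> \<in> space P. a \<le> infnorm (Z \<omega>)}
    \<le> prob (\<Union>e\<in>Basis. {\<omega> \<in> space P. a \<le> e \<bullet> Z \<omega>} \<union> {\<omega> \<in> space P. a \<le> (- e) \<bullet> Z \<omega>})"
    by (rule finite_measure_mono) (intro sets.finite_UN finite_Basis sets.Un ev)
  also have "\<dots> \<le> (\<Sum>e\<in>(Basis :: (real^'m) set). prob ({\<omega> \<in> space P. a \<le> e \<bullet> Z \<omega>} \<union> {\<omega> \<in> space P. a \<le> (- e) \<bullet> Z \<omega>}))"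
    by (intro finite_measure_subadditive_finite finite_Basis image_subsetI sets.Un ev)
  also have "\<dots> \<le> (\<Sum>e\<in>(Basis :: (real^'m) set). 2 * ?b)"
  proof (rule sum_mono)
    fix e :: "real^'m" assume "e \<in> Basis"
    then have "prob {\<omega> \<in> space P. a \<le> e \<bullet> Z \<omega>} \<le> ?b" "prob {\<omega> \<in> space P. a \<le> (- e) \<bullet> Z \<omega>} \<le> ?b"
      by (intro tail; simp)+
    then show "prob ({\<omega> \<in> space P. a \<le> e \<bullet> Z \<omega>} \<union> {\<omega> \<in> space P. a \<le> (- e) \<bullet> Z \<omega>}) \<le> 2 * ?b"
      by (intro order_trans[OF measure_Un_le[OF ev ev]]) simp
  qed
  also have "\<dots> = 2 * real CARD('m) * ?b" by simp
  finally show "prob {\<omega> \<in> space P. a \<le> infnorm (Z \<omega>)} \<le> 2 * real CARD('m) * ?b" .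
qed

end

subsection \<open>Independence of the current samples from the past\<close>

lemma borel_measurable_infnorm [measurable (raw)]:
  fixes f :: "'a \<Rightarrow> 'b::euclidean_space"
  assumes "f \<in> borel_measurable F"
  shows "(\<lambda>\<omega>. infnorm (f \<omega>)) \<in> borel_measurable F"
  using assms
  by (rule measurable_compose) (intro borel_measurable_continuous_onI continuous_on_infnorm continuous_on_id)

lemma borel_measurable_path_integral_control:
  assumes "\<And>i. i < n \<Longrightarrow> (\<lambda>\<omega>. r \<omega> i) \<in> borel_measurable F"
    "\<And>i. i < n \<Longrightarrow> (\<lambda>\<omega>. u \<omega> i) \<in> borel_measurable F"
  shows "(\<lambda>\<omega>. path_integral_control n (r \<omega>) (u \<omega>)) \<in> borel_measurable F"
proof -
  have [measurable]: "(\<lambda>\<omega>. r \<omega> i) \<in> borel_measurable F" "(\<lambda>\<omega>. u \<omega> i) \<in> borel_measurable F"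
    if "i \<in> {..<n}" for i using assms that by auto
  show ?thesis unfolding path_integral_control_def by measurable
qed

section \<open>Sigma-algebras generated by blocks of sources\<close>

definition source_algebra ::
  "'w measure \<Rightarrow> ('w \<Rightarrow> real^'n) \<Rightarrow> (nat \<Rightarrow> 'w \<Rightarrow> real^'n) \<Rightarrow> (nat \<Rightarrow> nat \<Rightarrow> nat \<Rightarrow> 'w \<Rightarrow> real^'m)
    \<Rightarrow> source set \<Rightarrow> 'w measure" where
  "source_algebra P X0 W V I = sigma (space P) (\<Union>s\<in>I. source_events P X0 W V s)"

lemma generated_events_subset: "generated_events P Y \<subseteq> Pow (space P)"
  by (auto simp: generated_events_def)

lemma source_events_subset: "source_events P X0 W V s \<subseteq> Pow (space P)"
  by (simp add: source_events_def generated_events_subset split: source.split)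

text \<open>Intersection stability is what lets independence of the single sources pass to the
  sigma-algebras generated by disjoint blocks of them.\<close>

lemma Int_stable_generated_events: "Int_stable (generated_events P Y)"
proof (rule Int_stableI)
  fix a b assume "a \<in> generated_events P Y" "b \<in> generated_events P Y"
  then obtain C D where "C \<in> sets borel" "D \<in> sets borel" "a = Y -` C \<inter> space P" "b = Y -` D \<inter> space P"
    by (auto simp: generated_events_def)
  then have "C \<inter> D \<in> sets borel" "a \<inter> b = Y -` (C \<inter> D) \<inter> space P" by auto
  then show "a \<inter> b \<in> generated_events P Y" unfolding generated_events_def by blast
qed

lemma Int_stable_source_events: "Int_stable (source_events P X0 W V s)"
  by (simp add: source_events_def Int_stable_generated_events split: source.split)

lemma space_source_algebra [simp]: "space (source_algebra P X0 W V I) = space P"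
  by (simp add: source_algebra_def space_measure_of_conv)

lemma sets_source_algebra:
  "sets (source_algebra P X0 W V I) = sigma_sets (space P) (\<Union>s\<in>I. source_events P X0 W V s)"
  unfolding source_algebra_def using source_events_subset[of P X0 W V] by (intro sets_measure_of) blast

lemma measurable_source_algebra_mono:
  assumes "I \<subseteq> I'"
  shows "borel_measurable (source_algebra P X0 W V I) \<subseteq> borel_measurable (source_algebra P X0 W V I')"
proof (rule measurable_mono)
  show "sets (source_algebra P X0 W V I) \<subseteq> sets (source_algebra P X0 W V I')"
    unfolding sets_source_algebra using assms by (intro sigma_sets_subseteq) auto
qed simp_all

lemma measurable_source_algebra:
  fixes Y :: "'w \<Rightarrow> 'b::topological_space"
  assumes "s \<in> I" "source_events P X0 W V s = generated_events P Y"
  shows "Y \<in> borel_measurable (source_algebra P X0 W V I)"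
proof (rule measurableI)
  fix C assume "C \<in> sets (borel :: 'b measure)"
  then have "Y -` C \<inter> space P \<in> source_events P X0 W V s"
    unfolding assms(2) by (auto simp: generated_events_def)
  then show "Y -` C \<inter> space (source_algebra P X0 W V I) \<in> sets (source_algebra P X0 W V I)"
    unfolding sets_source_algebra space_source_algebra using assms(1) by (intro sigma_sets.Basic) auto
qed simp

text \<open>A trajectory sampled at time \<open>s < t\<close> runs up to the horizon, so its
  controls at times \<open>k \<ge> t\<close> also belong to the past: the cut is by sampling time,
  not by control time.\<close>

definition past_sources :: "nat \<Rightarrow> (nat \<Rightarrow> nat) \<Rightarrow> nat \<Rightarrow> source set" where
  "past_sources T n t = {Init} \<union> {Disturbance s |s. s < t} \<union>
     {Sample s i k |s i k. s < t \<and> i < n s \<and> s \<le> k \<and> k < T}"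

definition current_samples :: "nat \<Rightarrow> (nat \<Rightarrow> nat) \<Rightarrow> nat \<Rightarrow> source set" where
  "current_samples T n t = {Sample t i k |i k. i < n t \<and> t \<le> k \<and> k < T}"

text \<open>By induction, the next state is a measurable function of the current state, the samples
  drawn at the current time and the disturbance. Samples of time \<open>t\<close> thus enter the
  past only at \<open>Suc t\<close>.\<close>

lemma state_measurable:
  assumes dyn: "\<And>t \<omega>. t < T \<Longrightarrow> \<omega> \<in> space P \<Longrightarrow> X (Suc t) \<omega> = A t *v X t \<omega>
      + B t *v path_integral_control (n t) (\<lambda>i. path_weight A B M lam T t (X t \<omega>) (\<lambda>k. V t i k \<omega>)) (\<lambda>i. V t i t \<omega>)
      + W t \<omega>"
    and "t \<le> T"
  shows "X t \<in> borel_measurable (source_algebra P (X 0) W V (past_sources T n t))"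
  using assms(2)
proof (induction t)
  case 0
  show ?case
    by (rule measurable_source_algebra[of Init]) (auto simp: past_sources_def source_events_def)
next
  case (Suc t)
  let ?F = "source_algebra P (X 0) W V (past_sources T n (Suc t))"
  have "past_sources T n t \<subseteq> past_sources T n (Suc t)"
    unfolding past_sources_def by (auto intro: less_SucI)
  then have X: "X t \<in> borel_measurable ?F"
    using Suc measurable_source_algebra_mono by (meson Suc_leD subsetD)
  have V: "V t i k \<in> borel_measurable ?F" if "i < n t" "t \<le> k" "k < T" for i k
    by (rule measurable_source_algebra[of "Sample t i k"]) (use that in \<open>auto simp: past_sources_def source_events_def\<close>)
  have W: "W t \<in> borel_measurable ?F"
    by (rule measurable_source_algebra[of "Disturbance t"]) (auto simp: past_sources_def source_events_def)
  have U: "(\<lambda>\<omega>. path_integral_control (n t) (\<lambda>i. path_weight A B M lam T t (X t \<omega>) (\<lambda>k. V t i k \<omega>)) (\<lambda>i. V t i t \<omega>))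
      \<in> borel_measurable ?F"
    using Suc(2) by (intro borel_measurable_path_integral_control borel_measurable_path_weight X V) auto
  have "(\<lambda>\<omega>. A t *v X t \<omega>
      + B t *v path_integral_control (n t) (\<lambda>i. path_weight A B M lam T t (X t \<omega>) (\<lambda>k. V t i k \<omega>)) (\<lambda>i. V t i t \<omega>)
      + W t \<omega>) \<in> borel_measurable ?F"
    by (intro borel_measurable_add borel_measurable_matrix_vector_mult X U W)
  then show ?case
    \<comment> \<open>The dynamics hold only on \<open>space P\<close>, so measurability is
      transferred by congruence rather than by rewriting \<open>X (Suc t)\<close>.\<close>
    using dyn Suc(2) by (subst measurable_cong) auto
qed

context prob_space
begin

lemma indep_sets_current_samples:
  assumes "indep_sets (source_events M X0 W V) (source_indices T n)" "t < T"
  shows "indep_vars (\<lambda>_. borel) (\<lambda>p. V t (fst p) (snd p)) ({..<n t} \<times> {t..<T})"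
proof -
  let ?f = "\<lambda>p. Sample t (fst p) (snd p)"
  have "?f ` ({..<n t} \<times> {t..<T}) \<subseteq> source_indices T n"
    using assms(2) by (auto simp: source_indices_def)
  then have "indep_sets (source_events M X0 W V) (?f ` ({..<n t} \<times> {t..<T}))"
    using assms(1) by (rule indep_sets_mono_index)
  moreover have "inj_on ?f ({..<n t} \<times> {t..<T})"
    by (auto simp: inj_on_def)
  ultimately have "indep_sets (\<lambda>p. source_events M X0 W V (?f p)) ({..<n t} \<times> {t..<T})"
    by (rule indep_sets_reindex[rotated])
  then have ind: "indep_sets (\<lambda>p. {V t (fst p) (snd p) -` S \<inter> space M |S. S \<in> sets borel}) ({..<n t} \<times> {t..<T})"
    by (simp add: source_events_def generated_events_def)
  have "random_variable borel (V t (fst p) (snd p))" if "p \<in> {..<n t} \<times> {t..<T}" for p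
  proof (rule measurableI)
    \<comment> \<open>Measurability of the samples is read off from \<open>indep_sets\<close>, which
      requires every family to consist of events.\<close>
    have sub: "{V t (fst p) (snd p) -` S \<inter> space M |S. S \<in> sets borel} \<subseteq> events"
      using ind that unfolding indep_sets_def by (rule_tac bspec[of _ _ p]) simp_all
    show "V t (fst p) (snd p) -` S \<inter> space M \<in> events" if "S \<in> sets borel" for S
      using sub that by blast
  qed simp
  with ind show ?thesis unfolding indep_vars_def2 by blast
qed

text \<open>The past and the current samples are two disjoint blocks of independent sources. The
  state is measurable with respect to the first and the sample array with respect to the
  second.\<close>

lemma indep_past_current:
  fixes V :: "nat \<Rightarrow> nat \<Rightarrow> nat \<Rightarrow> 'a \<Rightarrow> real^'m"
  assumes indep: "indep_sets (source_events M X0 W V) (source_indices T n)" and t: "t < T"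
    and X: "X \<in> borel_measurable (source_algebra M X0 W V (past_sources T n t))"
  defines "J \<equiv> {..<n t} \<times> {t..<T}"
  shows "X \<in> borel_measurable M"
    and "indep_set (generated_sets borel X)
      (generated_sets (PiM J (\<lambda>_. borel)) (\<lambda>\<omega>. \<lambda>p\<in>J. V t (fst p) (snd p) \<omega>))"
proof -
  let ?E = "source_events M X0 W V"
  let ?I = "case_bool (past_sources T n t) (current_samples T n t)"
  have sub: "past_sources T n t \<subseteq> source_indices T n" "current_samples T n t \<subseteq> source_indices T n"
    using t by (auto simp: past_sources_def current_samples_def source_indices_def)
  have "?E s \<subseteq> events" if "s \<in> source_indices T n" for s
    using indep that by (simp add: indep_sets_def)
  then have "(\<Union>s\<in>past_sources T n t. ?E s) \<subseteq> events" using sub by blast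
  then have "sets (source_algebra M X0 W V (past_sources T n t)) \<subseteq> events"
    unfolding sets_source_algebra by (rule sets.sigma_sets_subset)
  then show "X \<in> borel_measurable M"
    using X measurable_mono[of borel borel "source_algebra M X0 W V (past_sources T n t)" M] by auto
  have "indep_sets (\<lambda>j. sigma_sets (space M) (\<Union>s\<in>?I j. ?E s)) UNIV"
  proof (rule indep_sets_collect_sigma)
    show "indep_sets ?E (\<Union>j\<in>UNIV. ?I j)"
      using sub by (intro indep_sets_mono_index[OF _ indep]) (simp add: UNIV_bool)
    show "disjoint_family_on ?I UNIV"
      unfolding disjoint_family_on_def UNIV_bool by (auto simp: past_sources_def current_samples_def)
  qed (rule Int_stable_source_events)
  then show "indep_set (generated_sets borel X)
      (generated_sets (PiM J (\<lambda>_. borel)) (\<lambda>\<omega>. \<lambda>p\<in>J. V t (fst p) (snd p) \<omega>))"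
    unfolding indep_set_def
  proof (rule indep_sets_mono_sets)
    fix j :: bool
    have "generated_sets borel X \<subseteq> sets (source_algebra M X0 W V (past_sources T n t))"
      unfolding generated_sets_def using measurable_sets[OF X] by auto
    moreover have VV: "(\<lambda>\<omega>. \<lambda>p\<in>J. V t (fst p) (snd p) \<omega>)
        \<in> source_algebra M X0 W V (current_samples T n t) \<rightarrow>\<^sub>M PiM J (\<lambda>_. borel)"
    proof (rule measurable_restrict)
      fix p assume "p \<in> J"
      then show "V t (fst p) (snd p) \<in> borel_measurable (source_algebra M X0 W V (current_samples T n t))"
        by (intro measurable_source_algebra[of "Sample t (fst p) (snd p)"])
           (auto simp: J_def current_samples_def source_events_def)
    qed
    have "generated_sets (PiM J (\<lambda>_. borel)) (\<lambda>\<omega>. \<lambda>p\<in>J. V t (fst p) (snd p) \<omega>)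
        \<subseteq> sets (source_algebra M X0 W V (current_samples T n t))"
      unfolding generated_sets_def using measurable_sets[OF VV] by auto
    ultimately show "case_bool (generated_sets borel X)
        (generated_sets (PiM J (\<lambda>_. borel)) (\<lambda>\<omega>. \<lambda>p\<in>J. V t (fst p) (snd p) \<omega>)) j
      \<subseteq> sigma_sets (space M) (\<Union>s\<in>?I j. ?E s)"
      by (cases j) (simp_all add: sets_source_algebra)
  qed
qed

end

section \<open>From the deviation sum to the control error\<close>

lemma path_integral_control_error:
  fixes w :: "nat \<Rightarrow> real" and v :: "nat \<Rightarrow> real^'m" and c :: "real^'m"
  assumes E: "0 < emp_r n w" and \<epsilon>: "0 < \<epsilon>" and s: "0 \<le> s" and q: "0 \<le> q"
    and n: "((emp_r n w * sqrt s + q)\<^sup>2 / (\<epsilon>\<^sup>2 * emp_r n w ^ 4)) \<le> real n"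
    and Z: "infnorm (\<Sum>i<n. w i *\<^sub>R (v i - c)) \<le> sqrt (real n * s)"
  shows "infnorm (path_integral_control n w v - c) \<le> \<epsilon>"
proof -
  define e where "e = emp_r n w"
  have e: "0 < e" using E by (simp add: e_def)
  \<comment> \<open>Division by zero gives 0, so \<open>emp_r 0 w = 0\<close> and positivity of
    \<open>emp_r\<close> excludes an empty sample.\<close>
  have n0: "0 < real n" using E by (cases "n = 0") (simp_all add: emp_r_def)
  have R: "(\<Sum>i<n. w i) = real n * e" using n0 by (simp add: e_def emp_r_def)
  have R0: "0 < real n * e" using n0 e by simp
  \<comment> \<open>The normalised weights sum to 1, so \<open>c\<close> can be moved inside the
    average. The denominator is the observed total weight, not its expectation.\<close>
  have "path_integral_control n w v - c = (1 / (real n * e)) *\<^sub>R (\<Sum>i<n. w i *\<^sub>R (v i - c))"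
    using n0 e unfolding path_integral_control_def R
    by (simp add: scaleR_diff_right sum_subtractf scaleR_right.sum[symmetric] scaleR_left.sum[symmetric] R
        scaleR_sum_right)
  then have err: "infnorm (path_integral_control n w v - c)
      = infnorm (\<Sum>i<n. w i *\<^sub>R (v i - c)) / (real n * e)"
    using R0 by (simp add: infnorm_mul)
  \<comment> \<open>The sample-size condition implies \<open>s \<le> n \<epsilon>^2 e^2\<close>,
    that is, the deviation threshold \<open>sqrt (n * s)\<close> is at most
    \<open>\<epsilon>\<close> times the total weight \<open>n * e\<close>.\<close>
  have "(e * sqrt s)\<^sup>2 \<le> (e * sqrt s + q)\<^sup>2"
    using e s q by (intro power_mono) simp_all
  also have "\<dots> \<le> real n * (\<epsilon>\<^sup>2 * e ^ 4)"
    using n e \<epsilon> by (simp add: e_def[symmetric] divide_le_eq)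
  finally have "s * e\<^sup>2 \<le> (real n * \<epsilon>\<^sup>2 * e\<^sup>2) * e\<^sup>2"
    using s by (simp add: power_mult_distrib power2_eq_square power4_eq_xxxx ac_simps)
  then have "s \<le> real n * \<epsilon>\<^sup>2 * e\<^sup>2"
    using e by (simp add: mult_le_cancel_right)
  then have "real n * s \<le> real n * (real n * \<epsilon>\<^sup>2 * e\<^sup>2)"
    by (rule mult_left_mono) simp
  also have "\<dots> = (\<epsilon> * (real n * e))\<^sup>2"
    by (simp add: power2_eq_square)
  finally have "sqrt (real n * s) \<le> \<epsilon> * (real n * e)"
    using \<epsilon> R0 by (intro real_le_lsqrt) simp_all
  with Z R0 show ?thesis unfolding err by (simp add: divide_le_eq)
qed

theorem theorem20:
  fixes P :: "'w measure"
    and T :: nat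
    and A M \<Omega> :: "nat \<Rightarrow> real^'n^'n"
    and B :: "nat \<Rightarrow> real^'m^'n"
    and N \<Omega>hat :: "nat \<Rightarrow> real^'m^'m"
    and lam :: real
    and X W :: "nat \<Rightarrow> 'w \<Rightarrow> real^'n"
    and V :: "nat \<Rightarrow> nat \<Rightarrow> nat \<Rightarrow> 'w \<Rightarrow> real^'m"
    and n :: "nat \<Rightarrow> nat"
    and \<epsilon> \<alpha> \<beta> :: "nat \<Rightarrow> real"
    and r :: "nat \<Rightarrow> nat \<Rightarrow> 'w \<Rightarrow> real"
    and Er :: "nat \<Rightarrow> 'w \<Rightarrow> real"
    and Eru uhat u :: "nat \<Rightarrow> 'w \<Rightarrow> real^'m"
  defines "r \<equiv> (\<lambda>t i \<omega>. path_weight A B M lam T t (X t \<omega>) (\<lambda>k. V t i k \<omega>))"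
    and "Er \<equiv> (\<lambda>t \<omega>. emp_r (n t) (\<lambda>i. r t i \<omega>))"
    and "Eru \<equiv> (\<lambda>t \<omega>. emp_ru (n t) (\<lambda>i. r t i \<omega>) (\<lambda>i. V t i t \<omega>))"
    and "uhat \<equiv> (\<lambda>t \<omega>. path_integral_control (n t) (\<lambda>i. r t i \<omega>) (\<lambda>i. V t i t \<omega>))"
    and "u \<equiv> (\<lambda>t \<omega>. lqr_gain A B M N T t *v X t \<omega>)"
  assumes "prob_space P"
    and "\<And>t. t \<le> T \<Longrightarrow> pos_definite (M t)"
    and "\<And>t. t < T \<Longrightarrow> pos_definite (N t)"
    and "0 < lam"
    and "\<And>t. t < T \<Longrightarrow> pos_definite (\<Omega>hat t)"
    and "\<And>t. t < T \<Longrightarrow> N t = lam *\<^sub>R matrix_inv (\<Omega>hat t)"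
    and "\<And>t. t < T \<Longrightarrow> B t ** \<Omega>hat t ** transpose (B t) = \<Omega> t"
    and "X 0 \<in> borel_measurable P"
    and "\<And>t. t < T \<Longrightarrow> centered_normal P (W t) (\<Omega> t)"
    and "\<And>t i k. t < T \<Longrightarrow> i < n t \<Longrightarrow> t \<le> k \<Longrightarrow> k < T \<Longrightarrow> centered_normal P (V t i k) (\<Omega>hat k)"
    and "prob_space.indep_sets P (source_events P (X 0) W V) (source_indices T n)"
    and "\<And>t \<omega>. t < T \<Longrightarrow> \<omega> \<in> space P \<Longrightarrow>
           X (Suc t) \<omega> = A t *v X t \<omega> + B t *v uhat t \<omega> + W t \<omega>"
    and "\<And>t. t < T \<Longrightarrow> 0 < n t"
    and "\<And>t. t < T \<Longrightarrow> 0 < \<epsilon> t"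
    and "\<And>t. t < T \<Longrightarrow> 0 < \<alpha> t"
    and "\<And>t. t < T \<Longrightarrow> 0 < \<beta> t"
    and "(\<Sum>t<T. \<alpha> t) + (\<Sum>t<T. \<beta> t) < 1"
  shows "measure P {\<omega> \<in> space P.
           (\<forall>t<T.
              real (n t) \<ge>
                (Er t \<omega> * sqrt (2 * onorm ((*v) (\<Omega>hat t)) * ln (2 * real CARD('m) / \<beta> t))
                   + (\<epsilon> t * Er t \<omega> + infnorm (Eru t \<omega>)) * sqrt (1 / 2 * ln (2 / \<alpha> t)))\<^sup>2
                / ((\<epsilon> t)\<^sup>2 * (Er t \<omega>) ^ 4)
              \<and> Er t \<omega> > sqrt (1 / (2 * real (n t)) * ln (2 / \<alpha> t)))
           \<longrightarrow> (\<Sum>t<T. (infnorm (uhat t \<omega> - u t \<omega>))\<^sup>2) \<le> (\<Sum>t<T. (\<epsilon> t)\<^sup>2)}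
         \<ge> 1 - (\<Sum>t<T. \<alpha> t) - (\<Sum>t<T. \<beta> t)"
proof -
  interpret prob_space P by fact
  note M = assms(7) and N = assms(8) and lam = assms(9) and \<Omega> = assms(10) and N_eq = assms(11)
    and normal = assms(15) and indep = assms(16) and dyn = assms(17) and n = assms(18)
    and \<epsilon> = assms(19) and \<alpha> = assms(20) and \<beta> = assms(21)
  define J where "J t = {..<n t} \<times> {t..<T}" for t
  define Z where "Z t \<omega> = (\<Sum>i<n t. r t i \<omega> *\<^sub>R (V t i t \<omega> - u t \<omega>))" for t \<omega>
  \<comment> \<open>Calibrated so that the Chernoff bound at threshold \<open>sqrt (n * s)\<close>
    equals \<open>\<beta> / (2 m)\<close> for each of the \<open>2 m\<close> signed
    coordinates.\<close>
  define s where "s t = 2 * onorm ((*v) (\<Omega>hat t)) * ln (2 * real CARD('m) / \<beta> t)" for t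
  define bad where "bad t = {\<omega> \<in> space P. sqrt (real (n t) * s t) \<le> infnorm (Z t \<omega>)}" for t
  define hyp where "hyp t \<omega> \<longleftrightarrow> real (n t) \<ge>
      (Er t \<omega> * sqrt (s t) + (\<epsilon> t * Er t \<omega> + infnorm (Eru t \<omega>)) * sqrt (1 / 2 * ln (2 / \<alpha> t)))\<^sup>2
        / ((\<epsilon> t)\<^sup>2 * (Er t \<omega>) ^ 4)
      \<and> Er t \<omega> > sqrt (1 / (2 * real (n t)) * ln (2 / \<alpha> t))" for t \<omega>
  \<comment> \<open>An implication inside the event: outcomes violating the sample-size conditions
    belong to it vacuously, so those conditions never need a probability.\<close>
  define good where "good = {\<omega> \<in> space P. (\<forall>t<T. hyp t \<omega>)
      \<longrightarrow> (\<Sum>t<T. (infnorm (uhat t \<omega> - u t \<omega>))\<^sup>2) \<le> (\<Sum>t<T. (\<epsilon> t)\<^sup>2)}"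
  have nonneg: "0 \<le> \<alpha> t" "0 \<le> \<beta> t" if "t < T" for t
    using \<alpha>[OF that] \<beta>[OF that] by simp_all
  \<comment> \<open>Each term is bounded by a total below 1, which makes the logarithms of
    \<open>2 / \<alpha>\<close> and \<open>2 m / \<beta>\<close> positive.\<close>
  have le: "\<alpha> t < 1" "\<beta> t < 1" if "t < T" for t
  proof -
    have "\<alpha> t \<le> (\<Sum>t<T. \<alpha> t)" "\<beta> t \<le> (\<Sum>t<T. \<beta> t)" "0 \<le> (\<Sum>t<T. \<alpha> t)" "0 \<le> (\<Sum>t<T. \<beta> t)"
      using that by (auto intro!: member_le_sum sum_nonneg nonneg)
    then show "\<alpha> t < 1" "\<beta> t < 1" using assms(22) by simp_all
  qed
  have onorm_pos: "0 < onorm ((*v) (\<Omega>hat t))" if "t < T" for t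
    using \<Omega>[OF that] by (rule onorm_pos_definite_pos)
  have ln_pos: "0 < ln (2 * real CARD('m) / \<beta> t)" if "t < T" for t
  proof -
    have "1 \<le> real CARD('m)" by (simp add: Suc_le_eq)
    with le(2)[OF that] have "\<beta> t < 2 * real CARD('m)" by linarith
    then show ?thesis using \<beta>[OF that] by simp
  qed
  have s_pos: "0 < s t" if "t < T" for t
    unfolding s_def using onorm_pos[OF that] ln_pos[OF that] by simp
  have X_past: "X t \<in> borel_measurable (source_algebra P (X 0) W V (past_sources T n t))" if "t < T" for t
    using dyn[unfolded uhat_def r_def] less_imp_le[OF that] by (rule state_measurable)
  note X_indep = indep_past_current[OF indep _ X_past]
  have V_indep: "indep_vars (\<lambda>_. borel) (\<lambda>p. V t (fst p) (snd p)) ({..<n t} \<times> {t..<T})" if "t < T" for t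
    using indep that by (rule indep_sets_current_samples)
  have X[measurable]: "X t \<in> borel_measurable P" if "t < T" for t
    using that that by (rule X_indep(1))
  have V: "V t i k \<in> borel_measurable P" if "t < T" "i < n t" "t \<le> k" "k < T" for t i k
    using normal[OF that] by (simp add: centered_normal_def)
  have V_meas[measurable]: "V t i t \<in> borel_measurable P" if "t < T" "i \<in> {..<n t}" for t i
    using that by (intro V) auto
  have r_meas[measurable]: "r t i \<in> borel_measurable P" if "t < T" "i \<in> {..<n t}" for t i
    unfolding r_def using that by (intro borel_measurable_path_weight X V) auto
  have bad: "bad t \<in> sets P" "prob (bad t) \<le> \<beta> t" if t: "t < T" for t
  proof -
    have pos: "0 < sqrt (real (n t) * s t)" using n[OF t] s_pos[OF t] by simp
    have Z_eq: "Z t = (\<lambda>\<omega>. \<Sum>i<n t. path_weight A B M lam T t (X t \<omega>) (\<lambda>k. V t i k \<omega>)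
        *\<^sub>R (V t i t \<omega> - lqr_gain A B M N T t *v X t \<omega>))"
      unfolding Z_def r_def u_def ..
    note tail = sample_sum_tail[OF prob_space_axioms M N lam \<Omega> N_eq t n[OF t] pos normal[OF t]
      V_indep[OF t] X[OF t] X_indep(2)[OF t t]]
    have [measurable]: "Z t \<in> borel_measurable P" unfolding Z_eq by (rule tail(1))
    show "bad t \<in> sets P" unfolding bad_def by measurable
    \<comment> \<open>The sample size and the operator norm cancel, leaving the logarithm whose
      exponential gives back \<open>\<beta> t\<close>.\<close>
    have "- (sqrt (real (n t) * s t))\<^sup>2 / (2 * (real (n t) * onorm ((*v) (\<Omega>hat t))))
        = - ln (2 * real CARD('m) / \<beta> t)"
      using n[OF t] s_pos[OF t] onorm_pos[OF t] unfolding s_def by simp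
    then have "prob (bad t) \<le> 2 * real CARD('m) * exp (- ln (2 * real CARD('m) / \<beta> t))"
      using tail(2) unfolding bad_def Z_eq by simp
    also have "\<dots> = \<beta> t" using \<beta>[OF t] by (simp add: exp_minus)
    finally show "prob (bad t) \<le> \<beta> t" .
  qed
  have error: "infnorm (uhat t \<omega> - u t \<omega>) \<le> \<epsilon> t"
    if t: "t < T" and \<omega>: "\<omega> \<in> space P" "\<omega> \<notin> bad t" and h: "hyp t \<omega>" for t \<omega>
  proof -
    \<comment> \<open>\<open>sqrt\<close> is negative on negative arguments, so positivity of the
      logarithm is needed before the lower bound on \<open>Er\<close> yields
      \<open>0 < Er\<close>.\<close>
    have "0 < ln (2 / \<alpha> t)" using \<alpha>[OF t] le(1)[OF t] by simp
    then have "0 \<le> sqrt (1 / (2 * real (n t)) * ln (2 / \<alpha> t))" by simp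
    also have "\<dots> < Er t \<omega>" using h by (simp only: hyp_def)
    finally have E: "0 < Er t \<omega>" .
    show ?thesis
      unfolding uhat_def
    proof (rule path_integral_control_error[where s="s t"
          and q="(\<epsilon> t * Er t \<omega> + infnorm (Eru t \<omega>)) * sqrt (1 / 2 * ln (2 / \<alpha> t))"])
      show "0 \<le> (\<epsilon> t * Er t \<omega> + infnorm (Eru t \<omega>)) * sqrt (1 / 2 * ln (2 / \<alpha> t))"
        using E \<epsilon>[OF t] \<open>0 < ln (2 / \<alpha> t)\<close> by (simp add: infnorm_pos_le)
    qed (use E \<epsilon>[OF t] s_pos[OF t] h \<omega> in \<open>auto simp: hyp_def Er_def bad_def Z_def\<close>)
  qed
  have [measurable]: "Er t \<in> borel_measurable P" "Eru t \<in> borel_measurable P" "u t \<in> borel_measurable P"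
    if "t < T" for t
    using that unfolding Er_def Eru_def u_def emp_r_def emp_ru_def by measurable
  have [measurable]: "uhat t \<in> borel_measurable P" if "t < T" for t
    unfolding uhat_def using that by (intro borel_measurable_path_integral_control r_meas V_meas) auto
  have hyp_meas: "{\<omega> \<in> space P. hyp t \<omega>} \<in> sets P" if "t < T" for t
    using that unfolding hyp_def by measurable
  have "(\<lambda>\<omega>. \<Sum>t<T. (infnorm (uhat t \<omega> - u t \<omega>))\<^sup>2) \<in> borel_measurable P"
    by (intro borel_measurable_sum) simp
  then have "{\<omega> \<in> space P. (\<Sum>t<T. (infnorm (uhat t \<omega> - u t \<omega>))\<^sup>2) \<le> (\<Sum>t<T. (\<epsilon> t)\<^sup>2)} \<in> sets P"
    by measurable
  moreover have "{\<omega> \<in> space P. \<forall>t<T. hyp t \<omega>} \<in> sets P"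
  proof -
    have "{\<omega> \<in> space P. \<forall>t\<in>{..<T}. hyp t \<omega>} \<in> sets P"
      by (rule sets.sets_Collect_finite_All) (simp_all add: hyp_meas)
    then show ?thesis unfolding Ball_def lessThan_iff .
  qed
  ultimately have good_sets: "good \<in> sets P"
    unfolding good_def by (rule sets.sets_Collect_imp)
  have Un: "(\<Union>t<T. bad t) \<in> sets P" using bad(1) by auto
  have "space P - (\<Union>t<T. bad t) \<subseteq> good"
  proof
    fix \<omega> assume \<omega>: "\<omega> \<in> space P - (\<Union>t<T. bad t)"
    have "(\<Sum>t<T. (infnorm (uhat t \<omega> - u t \<omega>))\<^sup>2) \<le> (\<Sum>t<T. (\<epsilon> t)\<^sup>2)" if "\<forall>t<T. hyp t \<omega>"
    proof (rule sum_mono)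
      fix t assume "t \<in> {..<T}"
      then have "infnorm (uhat t \<omega> - u t \<omega>) \<le> \<epsilon> t"
        using \<omega> that by (intro error) auto
      then show "(infnorm (uhat t \<omega> - u t \<omega>))\<^sup>2 \<le> (\<epsilon> t)\<^sup>2"
        by (rule power_mono) (rule infnorm_pos_le)
    qed
    with \<omega> show "\<omega> \<in> good" unfolding good_def by blast
  qed
  then have "prob (space P - (\<Union>t<T. bad t)) \<le> prob good"
    using good_sets by (rule finite_measure_mono)
  moreover have "prob (\<Union>t<T. bad t) \<le> (\<Sum>t<T. \<beta> t)"
  proof -
    have "prob (\<Union>t<T. bad t) \<le> (\<Sum>t<T. prob (bad t))"
      using bad(1) by (intro finite_measure_subadditive_finite) auto
    also have "\<dots> \<le> (\<Sum>t<T. \<beta> t)" using bad(2) by (intro sum_mono) auto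
    finally show ?thesis .
  qed
  moreover have "0 \<le> (\<Sum>t<T. \<alpha> t)" by (intro sum_nonneg nonneg) simp
  ultimately have "1 - (\<Sum>t<T. \<alpha> t) - (\<Sum>t<T. \<beta> t) \<le> prob good"
    using prob_compl[OF Un] by simp
  then show ?thesis unfolding good_def hyp_def s_def .
qed

end
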